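(* Let $G$ be a locally compact, non-compact, amenable group with a fixed left Haar measure $\mu$. Then $\mathrm{Th}(L^{1}(G),* )$ is unstable.
   Context: Locally compact groups are Hausdorff topological groups. For a locally compact group $G$ with left Haar measure $\mu$, $(L^1(G),* )$ denotes the real Banach lattice $L^1(G,\mu)$ equipped with convolution $(f*g)(x)=\int_G f(y)g(y^{-1}x)\,d\mu(y)$, regarded as a metric structure in continuous first-order logic in the language $\mathcal{L}_{\mathrm{cnv}}=\{+,0,\wedge,\vee,\|\cdot\|,*\}$ with metric $d(f,g)=\|f-g\|_1$; formally one works in the unit ball, treating $+,\wedge,\vee$ as maps from the unit ball to the ball of radius $2$ (or rescaling them by $1/2$). $\mathrm{Th}$ is the complete continuous theory. A continuous theory $T$ is unstable if there exist a model $M$ of $T$, a formula $\varphi(\bar x,\bar y)$ and parameters $(\bar a_n)_{n<\omega},(\bar b_m)_{m<\omega}$ from $M$ such that both iterated limits $\lim_{n}\lim_{m}\varphi(\bar a_n,\bar b_m)$ and $\lim_{m}\lim_{n}\varphi(\bar a_n,\bar b_m)$ exist and are different. A locally compact group is amenable iff for every compact $K\subseteq G$ and $\epsilon>0$ there is a compact $E\subseteq G$ with $0<\mu(E)<\infty$ and $\mu(aE\triangle E)/\mu(E)<\epsilon$ for every $a\in K$. *)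

theory Defs
  imports "HOL-Analysis.Analysis"
begin

section \<open>Continuous first-order logic\<close>

text \<open>
  A continuous signature assigns to every function symbol an arity and a modulus of uniform
  continuity, and to every predicate symbol an arity, a modulus and a bounded closed range of
  values. The distance is always present; \<open>diam\<close> bounds its values.
\<close>

record ('f, 'p) csig =
  farity :: "'f \<Rightarrow> nat"
  fmod   :: "'f \<Rightarrow> real \<Rightarrow> real"
  parity :: "'p \<Rightarrow> nat"
  pmod   :: "'p \<Rightarrow> real \<Rightarrow> real"
  prange :: "'p \<Rightarrow> real set"
  diam   :: real

record ('f, 'p, 'm) cstruct =
  univ :: "'m set"
  cdist :: "'m \<Rightarrow> 'm \<Rightarrow> real"
  fint :: "'f \<Rightarrow> 'm list \<Rightarrow> 'm"
  pint :: "'p \<Rightarrow> 'm list \<Rightarrow> real"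

definition tuples :: "'m set \<Rightarrow> nat \<Rightarrow> 'm list set" where
  "tuples A n = {xs. length xs = n \<and> set xs \<subseteq> A}"

definition metric_structure :: "('f, 'p) csig \<Rightarrow> ('f, 'p, 'm) cstruct \<Rightarrow> bool" where
  "metric_structure L M \<longleftrightarrow>
     univ M \<noteq> {} \<and>
     Metric_space (univ M) (cdist M) \<and>
     Metric_space.mcomplete (univ M) (cdist M) \<and>
     (\<forall>x\<in>univ M. \<forall>y\<in>univ M. cdist M x y \<le> diam L) \<and>
     (\<forall>f. \<forall>xs\<in>tuples (univ M) (farity L f). fint M f xs \<in> univ M) \<and>
     (\<forall>f. \<forall>xs\<in>tuples (univ M) (farity L f). \<forall>ys\<in>tuples (univ M) (farity L f). \<forall>\<epsilon>>0.
        (\<forall>i<farity L f. cdist M (xs ! i) (ys ! i) < fmod L f \<epsilon>) \<longrightarrow>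
        cdist M (fint M f xs) (fint M f ys) \<le> \<epsilon>) \<and>
     (\<forall>p. \<forall>xs\<in>tuples (univ M) (parity L p). pint M p xs \<in> prange L p) \<and>
     (\<forall>p. \<forall>xs\<in>tuples (univ M) (parity L p). \<forall>ys\<in>tuples (univ M) (parity L p). \<forall>\<epsilon>>0.
        (\<forall>i<parity L p. cdist M (xs ! i) (ys ! i) < pmod L p \<epsilon>) \<longrightarrow>
        \<bar>pint M p xs - pint M p ys\<bar> \<le> \<epsilon>)"

datatype 'f cterm = Var nat | Fn 'f "'f cterm list"

text \<open>
  In \<open>Conn u \<phi>s\<close> the connective \<open>u\<close> is applied to the values of the finitely many formulas
  \<open>\<phi>s\<close>, padded by zeros. Since a continuous function on \<open>\<real>\<^sup>n\<close> is the restriction of a function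
  on sequences that is continuous in the product topology and depends on the first \<open>n\<close>
  coordinates only, the well-formed connectives are exactly the continuous functions
  from \<open>\<real>\<^sup>n\<close> to \<open>\<real>\<close>, for all \<open>n\<close>.
\<close>

datatype ('f, 'p) cform =
    Pred 'p "'f cterm list"
  | Dist "'f cterm" "'f cterm"
  | Conn "(nat \<Rightarrow> real) \<Rightarrow> real" "('f, 'p) cform list"
  | QSup nat "('f, 'p) cform"
  | QInf nat "('f, 'p) cform"

primrec wf_term :: "('f, 'p) csig \<Rightarrow> 'f cterm \<Rightarrow> bool" where
  "wf_term L (Var i) \<longleftrightarrow> True"
| "wf_term L (Fn f ts) \<longleftrightarrow> length ts = farity L f \<and> list_all (\<lambda>b. b) (map (wf_term L) ts)"

primrec wf_form :: "('f, 'p) csig \<Rightarrow> ('f, 'p) cform \<Rightarrow> bool" where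
  "wf_form L (Pred p ts) \<longleftrightarrow> length ts = parity L p \<and> (\<forall>t\<in>set ts. wf_term L t)"
| "wf_form L (Dist s t) \<longleftrightarrow> wf_term L s \<and> wf_term L t"
| "wf_form L (Conn u \<phi>s) \<longleftrightarrow> continuous_on UNIV u \<and> list_all (\<lambda>b. b) (map (wf_form L) \<phi>s)"
| "wf_form L (QSup i \<phi>) \<longleftrightarrow> wf_form L \<phi>"
| "wf_form L (QInf i \<phi>) \<longleftrightarrow> wf_form L \<phi>"

primrec fv_term :: "'f cterm \<Rightarrow> nat set" where
  "fv_term (Var i) = {i}"
| "fv_term (Fn f ts) = \<Union> (set (map fv_term ts))"

primrec fv_form :: "('f, 'p) cform \<Rightarrow> nat set" where
  "fv_form (Pred p ts) = \<Union> (set (map fv_term ts))"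
| "fv_form (Dist s t) = fv_term s \<union> fv_term t"
| "fv_form (Conn u \<phi>s) = \<Union> (set (map fv_form \<phi>s))"
| "fv_form (QSup i \<phi>) = fv_form \<phi> - {i}"
| "fv_form (QInf i \<phi>) = fv_form \<phi> - {i}"

primrec term_val :: "('f, 'p, 'm) cstruct \<Rightarrow> (nat \<Rightarrow> 'm) \<Rightarrow> 'f cterm \<Rightarrow> 'm" where
  "term_val M e (Var i) = e i"
| "term_val M e (Fn f ts) = fint M f (map (term_val M e) ts)"

primrec form_val :: "('f, 'p, 'm) cstruct \<Rightarrow> ('f, 'p) cform \<Rightarrow> (nat \<Rightarrow> 'm) \<Rightarrow> real" where
  "form_val M (Pred p ts) = (\<lambda>e. pint M p (map (term_val M e) ts))"
| "form_val M (Dist s t) = (\<lambda>e. cdist M (term_val M e s) (term_val M e t))"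
| "form_val M (Conn u \<phi>s) =
     (\<lambda>e. u (\<lambda>i. if i < length \<phi>s then (map (form_val M) \<phi>s ! i) e else 0))"
| "form_val M (QSup i \<phi>) = (\<lambda>e. SUP a\<in>univ M. form_val M \<phi> (e(i := a)))"
| "form_val M (QInf i \<phi>) = (\<lambda>e. INF a\<in>univ M. form_val M \<phi> (e(i := a)))"

definition sentence :: "('f, 'p) csig \<Rightarrow> ('f, 'p) cform \<Rightarrow> bool" where
  "sentence L \<phi> \<longleftrightarrow> wf_form L \<phi> \<and> fv_form \<phi> = {}"

text \<open>A theory is a set of sentences \<open>\<phi>\<close>, each standing for the condition \<open>\<phi> = 0\<close>.\<close>

definition satisfies :: "('f, 'p, 'm) cstruct \<Rightarrow> ('f, 'p) cform \<Rightarrow> bool" where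
  "satisfies M \<phi> \<longleftrightarrow> (\<forall>e. range e \<subseteq> univ M \<longrightarrow> form_val M \<phi> e = 0)"

definition models ::
    "('f, 'p) csig \<Rightarrow> ('f, 'p, 'm) cstruct \<Rightarrow> ('f, 'p) cform set \<Rightarrow> bool" where
  "models L M T \<longleftrightarrow> metric_structure L M \<and> (\<forall>\<phi>\<in>T. satisfies M \<phi>)"

definition Th :: "('f, 'p) csig \<Rightarrow> ('f, 'p, 'm) cstruct \<Rightarrow> ('f, 'p) cform set" where
  "Th L M = {\<phi>. sentence L \<phi> \<and> satisfies M \<phi>}"

definition iterated_limit :: "(nat \<Rightarrow> nat \<Rightarrow> real) \<Rightarrow> real \<Rightarrow> bool" where
  "iterated_limit F r \<longleftrightarrow>
     (\<exists>l. (\<forall>n. (\<lambda>m. F n m) \<longlonglongrightarrow> l n) \<and> l \<longlonglongrightarrow> r)"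

text \<open>
  In \<open>\<phi>(x, y)\<close> the tuple \<open>x\<close> consists of the variables \<open>0, \<dots>, k - 1\<close> and \<open>y\<close> of
  \<open>k, \<dots>, k + l - 1\<close>.

  The type argument is the type of the elements of the models considered, as HOL cannot
  quantify over types inside a formula. For a language with countably many symbols the
  restriction is immaterial as soon as this type has at least the cardinality of the
  continuum: by the downward Loewenheim-Skolem theorem, the parameters witnessing
  instability in any model lie in a separable elementary substructure, and a separable
  metric space has at most continuum many points.
\<close>

definition unstable ::
    "'m itself \<Rightarrow> ('f, 'p) csig \<Rightarrow> ('f, 'p) cform set \<Rightarrow> bool" where
  "unstable (_ :: 'm itself) L T \<longleftrightarrow>
     (\<exists>(M :: ('f, 'p, 'm) cstruct) \<phi> k l a b r s.
        models L M T \<and>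
        wf_form L \<phi> \<and> fv_form \<phi> \<subseteq> {..<k + l} \<and>
        (\<forall>n. a n \<in> tuples (univ M) k) \<and> (\<forall>m. b m \<in> tuples (univ M) l) \<and>
        iterated_limit (\<lambda>n m. form_val M \<phi> (\<lambda>i. (a n @ b m) ! i)) r \<and>
        iterated_limit (\<lambda>m n. form_val M \<phi> (\<lambda>i. (a n @ b m) ! i)) s \<and>
        r \<noteq> s)"


section \<open>Haar measure and amenability\<close>

text \<open>
  Groups are written additively; class \<^class>\<open>topological_group_add\<close> does not assume
  commutativity. So \<open>a + x\<close> is the product \<open>ax\<close> and \<open>- y + x\<close> is \<open>y\<^sup>-\<^sup>1x\<close>.
\<close>

definition left_haar_measure :: "'g::{topological_group_add, t2_space} measure \<Rightarrow> bool" where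
  "left_haar_measure \<mu> \<longleftrightarrow>
     sets \<mu> = sets borel \<and>
     emeasure \<mu> UNIV \<noteq> 0 \<and>
     (\<forall>a. \<forall>B\<in>sets borel. emeasure \<mu> ((\<lambda>x. a + x) ` B) = emeasure \<mu> B) \<and>
     (\<forall>K. compact K \<longrightarrow> emeasure \<mu> K < \<infinity>) \<and>
     (\<forall>B\<in>sets borel. emeasure \<mu> B = (INF U\<in>{U. open U \<and> B \<subseteq> U}. emeasure \<mu> U)) \<and>
     (\<forall>U. open U \<longrightarrow> emeasure \<mu> U = (SUP K\<in>{K. compact K \<and> K \<subseteq> U}. emeasure \<mu> K))"

definition amenable :: "'g::{topological_group_add, t2_space} measure \<Rightarrow> bool" where
  "amenable \<mu> \<longleftrightarrow>
     (\<forall>K \<epsilon>. compact K \<and> 0 < \<epsilon> \<longrightarrow>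
        (\<exists>E. compact E \<and> 0 < emeasure \<mu> E \<and> emeasure \<mu> E < \<infinity> \<and>
             (\<forall>a\<in>K. measure \<mu> (sym_diff ((\<lambda>x. a + x) ` E) E) / measure \<mu> E < \<epsilon>)))"


section \<open>The convolution structure on the unit ball of \<open>L\<^sup>1\<close>\<close>

text \<open>Elements of \<open>L\<^sup>1\<close> are classes of integrable functions modulo equality almost everywhere.\<close>

definition L1_class :: "'g measure \<Rightarrow> ('g \<Rightarrow> real) \<Rightarrow> ('g \<Rightarrow> real) set" where
  "L1_class \<mu> f = {g. integrable \<mu> g \<and> (AE x in \<mu>. g x = f x)}"

definition rep :: "('g \<Rightarrow> real) set \<Rightarrow> 'g \<Rightarrow> real" where
  "rep A = (SOME f. f \<in> A)"

definition L1_norm :: "'g measure \<Rightarrow> ('g \<Rightarrow> real) \<Rightarrow> real" where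
  "L1_norm \<mu> f = (\<integral>x. \<bar>f x\<bar> \<partial>\<mu>)"

definition L1_ball :: "'g measure \<Rightarrow> ('g \<Rightarrow> real) set set" where
  "L1_ball \<mu> = {L1_class \<mu> f | f. integrable \<mu> f \<and> L1_norm \<mu> f \<le> 1}"

definition convolution ::
    "'g::group_add measure \<Rightarrow> ('g \<Rightarrow> real) \<Rightarrow> ('g \<Rightarrow> real) \<Rightarrow> 'g \<Rightarrow> real" where
  "convolution \<mu> f g = (\<lambda>x. \<integral>y. f y * g (- y + x) \<partial>\<mu>)"

text \<open>
  The symbols \<open>+\<close>, \<open>\<and>\<close>, \<open>\<or>\<close> are interpreted on the unit ball by the operations rescaled by
  \<open>1/2\<close>.
\<close>

datatype cnv_fun = PlusS | ZeroS | MeetS | JoinS | ConvS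
datatype cnv_pred = NormS

definition L_cnv :: "(cnv_fun, cnv_pred) csig" where
  "L_cnv = \<lparr>
     farity = (\<lambda>f. case f of ZeroS \<Rightarrow> 0 | _ \<Rightarrow> 2),
     fmod = (\<lambda>f \<epsilon>. case f of ConvS \<Rightarrow> \<epsilon> / 2 | _ \<Rightarrow> \<epsilon>),
     parity = (\<lambda>_. 1),
     pmod = (\<lambda>_ \<epsilon>. \<epsilon>),
     prange = (\<lambda>_. {0..1}),
     diam = 2 \<rparr>"

definition L1_fint ::
    "'g::group_add measure \<Rightarrow> cnv_fun \<Rightarrow> ('g \<Rightarrow> real) set list \<Rightarrow> ('g \<Rightarrow> real) set" where
  "L1_fint \<mu> s As =
     (let f = rep (As ! 0); g = rep (As ! 1) in
      case s of
        PlusS \<Rightarrow> L1_class \<mu> (\<lambda>x. (f x + g x) / 2)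
      | ZeroS \<Rightarrow> L1_class \<mu> (\<lambda>x. 0)
      | MeetS \<Rightarrow> L1_class \<mu> (\<lambda>x. min (f x) (g x) / 2)
      | JoinS \<Rightarrow> L1_class \<mu> (\<lambda>x. max (f x) (g x) / 2)
      | ConvS \<Rightarrow> L1_class \<mu> (convolution \<mu> f g))"

definition L1_conv ::
    "'g::group_add measure \<Rightarrow> (cnv_fun, cnv_pred, ('g \<Rightarrow> real) set) cstruct" where
  "L1_conv \<mu> = \<lparr>
     univ = L1_ball \<mu>,
     cdist = (\<lambda>A B. L1_norm \<mu> (\<lambda>x. rep A x - rep B x)),
     fint = L1_fint \<mu>,
     pint = (\<lambda>_ As. L1_norm \<mu> (rep (As ! 0))) \<rparr>"

end

theory Submission
  imports Defs
begin

text \<open>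
  The structure \<open>L\<^sup>1(G)\<close> is itself a model with the order property, for the formula \<open>\<parallel>y * x\<parallel>\<close>.
  Fix a compact set \<open>K\<close> of positive measure and write \<open>\<psi>\<^sub>A\<close> for the normalized indicator of \<open>A\<close>. Choose
  alternately translates \<open>K\<^sub>m = a\<^sub>m + K\<close> and Folner sets \<open>E\<^sub>n\<close> such that \<open>E\<^sub>n\<close> is \<open>1/(n + 1)\<close>-invariant
  under \<open>K\<close> and \<open>K\<^sub>0, \<dots>, K\<^sub>n\<close>, while \<open>K\<^sub>m + E\<^sub>n\<close> is disjoint from \<open>K + E\<^sub>n\<close> for \<open>n < m\<close>; the latter is
  possible because \<open>G\<close> is not compact. Then \<open>\<parallel>(\<psi>\<^sub>K - \<psi>\<^sub>K\<^sub>m)/2 * \<psi>\<^sub>E\<^sub>n\<parallel>\<close> is \<open>1\<close> for \<open>n < m\<close> and at most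
  \<open>1/(n + 1)\<close> for \<open>m \<le> n\<close>.

  The analytic difficulty is that \<open>\<mu>\<close> need not be \<open>\<sigma>\<close>-finite and \<open>G\<close> need not be second countable. Two
  integrable functions vanish almost everywhere outside a common \<open>\<sigma>\<close>-compact subgroup, where \<open>\<mu>\<close> is
  \<open>\<sigma>\<close>-finite, and compact sets have Baire hulls of the same measure, for which the integrand of the
  convolution is measurable with respect to the product \<open>\<sigma>\<close>-algebra.
\<close>

section \<open>\<open>\<sigma>\<close>-compact sets and regularity\<close>

lemma ennreal_half_plus_half: "x / 2 + x / 2 = (x::ennreal)"
proof (cases x)
  case (real r)
  then show ?thesis by (simp add: ennreal_divide_numeral flip: ennreal_plus)
next
  case top
  then show ?thesis by (simp add: ennreal_top_divide)
qed

lemma ennreal_approx_SUP: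
  fixes f :: "'a \<Rightarrow> ennreal"
  assumes "(SUP i\<in>A. f i) < \<infinity>" "A \<noteq> {}" "0 < e"
  shows "\<exists>i\<in>A. (SUP i\<in>A. f i) < f i + e"
proof (rule ccontr)
  assume "\<not> ?thesis"
  then have "f i + e \<le> (SUP i\<in>A. f i)" if "i \<in> A" for i using that by (auto simp: not_less)
  then have "(SUP i\<in>A. f i + e) \<le> (SUP i\<in>A. f i)" by (rule SUP_least)
  then have "(SUP i\<in>A. f i) + e \<le> (SUP i\<in>A. f i)"
    using ennreal_SUP_add_left[OF assms(2), of f e] by simp
  then show False using assms(1,3)
    by (metis add.right_neutral ennreal_add_left_cancel_le infinity_ennreal_def leD top.not_eq_extremum top_neq_ennreal)
qed

definition sigma_compact :: "'a::topological_space set \<Rightarrow> bool" where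
  "sigma_compact S \<longleftrightarrow> (\<exists>K :: nat \<Rightarrow> 'a set. (\<forall>n. compact (K n)) \<and> S = (\<Union>n. K n))"

lemma sigma_compact_UN:
  fixes S :: "nat \<Rightarrow> 'a::topological_space set"
  assumes "\<And>n. sigma_compact (S n)"
  shows "sigma_compact (\<Union>n. S n)"
proof -
  obtain K :: "nat \<Rightarrow> nat \<Rightarrow> 'a set" where K: "\<And>n m. compact (K n m)" "\<And>n. S n = (\<Union>m. K n m)"
    using assms unfolding sigma_compact_def by metis
  have "(\<Union>n. S n) = (\<Union>i. K (fst (prod_decode i)) (snd (prod_decode i)))"
  proof (intro set_eqI iffI)
    fix x assume "x \<in> (\<Union>n. S n)"
    then obtain n m where "x \<in> K n m" using K by auto
    then have "x \<in> K (fst (prod_decode (prod_encode (n,m)))) (snd (prod_decode (prod_encode (n,m))))"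
      by simp
    then show "x \<in> (\<Union>i. K (fst (prod_decode i)) (snd (prod_decode i)))" by blast
  qed (use K in auto)
  then show ?thesis unfolding sigma_compact_def
    by (intro exI[of _ "\<lambda>i. K (fst (prod_decode i)) (snd (prod_decode i))"]) (simp add: K)
qed

lemma compact_imp_sigma_compact: "compact K \<Longrightarrow> sigma_compact K"
  unfolding sigma_compact_def by (rule exI[of _ "\<lambda>_. K"]) auto

lemma sigma_compact_Un:
  assumes "sigma_compact S" "sigma_compact T"
  shows "sigma_compact (S \<union> T)"
proof -
  have "S \<union> T = (\<Union>n::nat. if n = 0 then S else T)"
    by (auto split: if_splits)
  then show ?thesis
    using sigma_compact_UN[of "\<lambda>n. if n = 0 then S else T"] assms by (simp cong: if_cong)
qed

lemma compact_sumset: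
  fixes A B :: "'g::topological_group_add set"
  assumes "compact A" "compact B"
  shows "compact ((\<lambda>(a, b). a - b) ` (A \<times> B))" "compact ((\<lambda>(a, b). a + b) ` (A \<times> B))"
proof -
  have *: "compact (A \<times> B)" using assms by (rule compact_Times)
  show "compact ((\<lambda>(a, b). a - b) ` (A \<times> B))" "compact ((\<lambda>(a, b). a + b) ` (A \<times> B))"
    by (rule compact_continuous_image[OF _ *];
        simp add: case_prod_beta diff_conv_add_uminus del: add_uminus_conv_diff; intro continuous_intros)+
qed

text \<open>Differences are adjoined in stages, starting from {0}. Each stage is a continuous image
  of a compact set, and since x = x - 0 the stages increase, so any two elements occur in a common
  one. Containing 0 and closed under differences, the union is a subgroup.\<close>

lemma sigma_compact_generated_subgroup:
  fixes S :: "'g::topological_group_add set"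
  assumes "sigma_compact S"
  obtains H where "sigma_compact H" "S \<subseteq> H" "0 \<in> H" "\<forall>x\<in>H. \<forall>y\<in>H. x - y \<in> H"
proof -
  obtain K where K: "\<And>n::nat. compact (K n)" "S = (\<Union>n. K n)"
    using assms unfolding sigma_compact_def by auto
  define L where "L = rec_nat {0} (\<lambda>n A. (\<lambda>(a, b). a - b) ` ((A \<union> K n) \<times> (A \<union> K n)))"
  have L0: "L 0 = {0}" by (simp add: L_def)
  have LS: "L (Suc n) = (\<lambda>(a, b). a - b) ` ((L n \<union> K n) \<times> (L n \<union> K n))" for n
    by (simp add: L_def)
  have cL: "compact (L n)" for n
    by (induction n) (auto simp: L0 LS intro!: compact_sumset compact_Un K)
  have zL: "0 \<in> L n" for n
    by (induction n) (auto simp: L0 LS image_iff intro: bexI[of _ "(0,0)"])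
  have sub: "L n \<union> K n \<subseteq> L (Suc n)" for n
  proof
    fix x assume "x \<in> L n \<union> K n"
    then show "x \<in> L (Suc n)" unfolding LS using zL[of n] by (intro image_eqI[of _ _ "(x, 0)"]) auto
  qed
  have mono: "L i \<subseteq> L j" if "i \<le> j" for i j
    using lift_Suc_mono_le[of L i j] sub that by blast
  show thesis
  proof (rule that[of "\<Union>n. L n"])
    show "sigma_compact (\<Union>n. L n)" using cL unfolding sigma_compact_def by blast
    show "S \<subseteq> (\<Union>n. L n)" using sub K by blast
    show "0 \<in> (\<Union>n. L n)" using zL by auto
    show "\<forall>x\<in>\<Union>n. L n. \<forall>y\<in>\<Union>n. L n. x - y \<in> (\<Union>n. L n)"
    proof (intro ballI)
      fix x y assume "x \<in> (\<Union>n. L n)" "y \<in> (\<Union>n. L n)"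
      then obtain i j where "x \<in> L i" "y \<in> L j" by auto
      then have "x \<in> L (max i j)" "y \<in> L (max i j)" using mono[of i "max i j"] mono[of j "max i j"] by auto
      then have "x - y \<in> L (Suc (max i j))" unfolding LS by (intro image_eqI[of _ _ "(x, y)"]) auto
      then show "x - y \<in> (\<Union>n. L n)" by blast
    qed
  qed
qed

lemma sigma_compact_borel [measurable]:
  fixes S :: "'a::t2_space set"
  assumes "sigma_compact S"
  shows "S \<in> sets borel"
proof -
  obtain K where "\<And>n::nat. compact (K n)" "S = (\<Union>n. K n)"
    using assms unfolding sigma_compact_def by auto
  then show ?thesis by (simp add: borel_closed compact_imp_closed sets.countable_UN')
qed

lemma LIMSEQ_divide_Suc: "(\<lambda>n. 1 / real (Suc n)) \<longlonglongrightarrow> 0"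
  using LIMSEQ_inverse_real_of_nat by (simp only: inverse_eq_divide)

lemma Hausdorff_euclidean_t2: "Hausdorff_space (euclidean :: 'a::t2_space topology)"
  unfolding Hausdorff_space_def by (auto simp: disjnt_def separation_t2)

section \<open>The group with its Haar measure: translation invariance\<close>

locale haar =
  fixes \<mu> :: "'g::{topological_group_add, t2_space} measure"
  assumes locally_compact: "locally_compact_space (euclidean :: 'g topology)"
    and haar: "left_haar_measure \<mu>"
begin

lemma sets_haar [measurable_cong, simp]: "sets \<mu> = sets borel"
  using haar by (simp add: left_haar_measure_def)

lemma space_haar [simp]: "space \<mu> = UNIV"
  using sets_eq_imp_space_eq[OF sets_haar] by simp

lemmas haar_rules = haar[unfolded left_haar_measure_def, THEN conjunct2]

lemma emeasure_translate: "B \<in> sets borel \<Longrightarrow> emeasure \<mu> ((\<lambda>x. a + x) ` B) = emeasure \<mu> B"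
  by (rule haar_rules[THEN conjunct2, THEN conjunct1, rule_format])

lemma finite_on_compact: "compact K \<Longrightarrow> emeasure \<mu> K < \<infinity>"
  by (rule haar_rules[THEN conjunct2, THEN conjunct2, THEN conjunct1, rule_format])

lemma outer_regular:
  "B \<in> sets borel \<Longrightarrow> emeasure \<mu> B = (INF U\<in>{U. open U \<and> B \<subseteq> U}. emeasure \<mu> U)"
  by (rule haar_rules[THEN conjunct2, THEN conjunct2, THEN conjunct2, THEN conjunct1, rule_format])

lemma inner_regular_open:
  "open U \<Longrightarrow> emeasure \<mu> U = (SUP K\<in>{K. compact K \<and> K \<subseteq> U}. emeasure \<mu> K)"
  by (rule haar_rules[THEN conjunct2, THEN conjunct2, THEN conjunct2, THEN conjunct2, rule_format])

lemma measurable_translate [measurable]: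
  "(\<lambda>x. a + x) \<in> borel \<rightarrow>\<^sub>M (borel :: 'g measure)" "(\<lambda>y. - y + x) \<in> borel \<rightarrow>\<^sub>M (borel :: 'g measure)"
  by (intro borel_measurable_continuous_onI continuous_intros)+

text \<open>The preimage of a set under translation by \<open>a\<close> is its image under
  translation by \<open>- a\<close>, and left invariance is stated for images.\<close>

lemma distr_translate: "distr \<mu> \<mu> (\<lambda>x. a + x) = \<mu>"
proof (rule measure_eqI)
  fix B assume "B \<in> sets (distr \<mu> \<mu> (\<lambda>x. a + x))"
  then have B: "B \<in> sets borel" by simp
  have "(\<lambda>x. a + x) -` B \<inter> space \<mu> = (\<lambda>x. - a + x) ` B"
    by (force simp: add.assoc[symmetric] image_iff)
  moreover have "emeasure \<mu> ((\<lambda>x. - a + x) ` B) = emeasure \<mu> B"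
    using emeasure_translate[OF B] .
  ultimately show "emeasure (distr \<mu> \<mu> (\<lambda>x. a + x)) B = emeasure \<mu> B"
    using B by (subst emeasure_distr) auto
qed simp

lemma nn_integral_translate:
  assumes [measurable]: "f \<in> borel_measurable borel"
  shows "(\<integral>\<^sup>+x. f (a + x) \<partial>\<mu>) = (\<integral>\<^sup>+x. f x \<partial>\<mu>)"
  by (subst (2) distr_translate[symmetric, of a], subst nn_integral_distr) simp_all

lemma integrable_translate:
  fixes f :: "'g \<Rightarrow> real"
  shows "integrable \<mu> f \<Longrightarrow> integrable \<mu> (\<lambda>x. f (a + x))"
  by (rule integrable_distr[of _ _ \<mu>]) (simp_all add: distr_translate)

lemma AE_translate: "AE x in \<mu>. P x \<Longrightarrow> AE x in \<mu>. P (a + x)"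
  by (subst (asm) distr_translate[symmetric, of a], erule AE_distrD[rotated]) simp

section \<open>Approximation of Borel sets by open and compact sets\<close>

lemma outer_approx:
  assumes "B \<in> sets borel" "emeasure \<mu> B < \<infinity>" "0 < (e::ennreal)"
  shows "\<exists>V. open V \<and> B \<subseteq> V \<and> emeasure \<mu> V < \<infinity> \<and> emeasure \<mu> (V - B) < e"
proof -
  \<comment> \<open>The cap at 1 keeps \<open>d\<close> finite, so that \<open>V\<close> has finite
    measure even when \<open>e\<close> is infinite.\<close>
  define d where "d = min e 1"
  have d: "0 < d" "d \<le> e" "d < \<infinity>" using assms(3) by (auto simp: d_def min_less_iff_disj)
  have "emeasure \<mu> B < emeasure \<mu> B + d" using assms(2) d
    by (metis add.right_neutral ennreal_add_left_cancel_less infinity_ennreal_def less_top)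
  moreover have "emeasure \<mu> B = (INF U\<in>{U. open U \<and> B \<subseteq> U}. emeasure \<mu> U)"
    by (rule outer_regular[OF assms(1)])
  ultimately obtain V where V: "open V" "B \<subseteq> V" "emeasure \<mu> V < emeasure \<mu> B + d"
    by (metis (mono_tags, lifting) INF_less_iff mem_Collect_eq)
  have fin: "emeasure \<mu> V < \<infinity>" using V(3) assms(2) d
    by (metis ennreal_add_less_top infinity_ennreal_def order_less_trans)
  have "emeasure \<mu> (V - B) < d"
  proof (rule ccontr)
    assume "\<not> ?thesis"
    then have "emeasure \<mu> B + d \<le> emeasure \<mu> B + emeasure \<mu> (V - B)" by (simp add: add_left_mono not_less)
    also have "\<dots> = emeasure \<mu> V" using V assms(1)
      by (subst plus_emeasure) (auto simp: Un_absorb1)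
    finally show False using V(3) by simp
  qed
  then show ?thesis using V fin d by (auto intro!: exI[of _ V])
qed

lemma inner_approx_open:
  assumes "open V" "emeasure \<mu> V < \<infinity>" "0 < (e::ennreal)"
  shows "\<exists>K. compact K \<and> K \<subseteq> V \<and> emeasure \<mu> (V - K) < e"
proof -
  have eq: "emeasure \<mu> V = (SUP K\<in>{K. compact K \<and> K \<subseteq> V}. emeasure \<mu> K)"
    by (rule inner_regular_open[OF assms(1)])
  have "{K. compact K \<and> K \<subseteq> V} \<noteq> {}" by (auto intro: exI[of _ "{}"])
  from ennreal_approx_SUP[OF _ this assms(3), of "emeasure \<mu>"] eq assms(2)
  obtain K where K: "compact K" "K \<subseteq> V" "emeasure \<mu> V < emeasure \<mu> K + e"
    by auto
  have bK: "K \<in> sets borel" using K by (simp add: borel_closed compact_imp_closed)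
  have "emeasure \<mu> (V - K) < e"
  proof (rule ccontr)
    assume "\<not> ?thesis"
    then have "emeasure \<mu> K + e \<le> emeasure \<mu> K + emeasure \<mu> (V - K)" by (simp add: add_left_mono not_less)
    also have "\<dots> = emeasure \<mu> V" using K assms(1) bK
      by (subst plus_emeasure) (auto simp: Un_absorb1)
    finally show False using K(3) by simp
  qed
  then show ?thesis using K by auto
qed

text \<open>Inner regularity is given for open sets only. Inside an open \<open>V\<close> of finite
  measure around \<open>B\<close>, choose a compact \<open>K\<close> that fills almost all of
  \<open>V\<close>, and delete an open \<open>W\<close> that covers \<open>V - B\<close> with little
  excess. Then \<open>K - W\<close> is compact and lies in \<open>B\<close>.\<close>

lemma inner_approx:
  assumes B: "B \<in> sets borel" "emeasure \<mu> B < \<infinity>" and e: "0 < (e::ennreal)"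
  shows "\<exists>C. compact C \<and> C \<subseteq> B \<and> emeasure \<mu> (B - C) < e"
proof -
  have e2: "0 < e / 2" using e by (simp add: ennreal_zero_less_divide)
  obtain V where V: "open V" "B \<subseteq> V" "emeasure \<mu> V < \<infinity>" using outer_approx[OF B e] by blast
  obtain K where K: "compact K" "K \<subseteq> V" "emeasure \<mu> (V - K) < e / 2"
    using inner_approx_open[OF V(1,3) e2] by blast
  have VB: "V - B \<in> sets borel" "emeasure \<mu> (V - B) < \<infinity>"
    using V B by (auto intro: le_less_trans[OF emeasure_mono[of "V - B" V]])
  obtain W where W: "open W" "V - B \<subseteq> W" "emeasure \<mu> (W - (V - B)) < e / 2"
    using outer_approx[OF VB e2] by blast
  have bK: "K \<in> sets borel" using K by (simp add: borel_closed compact_imp_closed)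
  \<comment> \<open>A point of \<open>B\<close> outside \<open>K - W\<close> is either outside
    \<open>K\<close> or in \<open>W\<close>; in the second case it belongs to the excess of
    \<open>W\<close> over \<open>V - B\<close>.\<close>
  have "emeasure \<mu> (B - (K - W)) \<le> emeasure \<mu> ((V - K) \<union> (W - (V - B)))"
    using V W bK B by (intro emeasure_mono) auto
  also have "\<dots> \<le> emeasure \<mu> (V - K) + emeasure \<mu> (W - (V - B))"
    using V W bK B by (intro emeasure_subadditive) auto
  also have "\<dots> < e / 2 + e / 2" using K W by (intro add_strict_mono) auto
  also have "\<dots> = e" by (rule ennreal_half_plus_half)
  finally have "emeasure \<mu> (B - (K - W)) < e" .
  moreover have "compact (K - W)" using K W by (simp add: compact_diff)
  moreover have "K - W \<subseteq> B" using K W by auto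
  ultimately show ?thesis by blast
qed

lemma borel_compact_group: "compact (K :: 'g set) \<Longrightarrow> K \<in> sets borel"
  by (simp add: borel_closed compact_imp_closed)

lemma sigma_compact_approx:
  assumes B: "B \<in> sets borel" "emeasure \<mu> B < \<infinity>"
  obtains C :: "nat \<Rightarrow> 'g set" where "\<And>n. compact (C n)" "\<And>n. C n \<subseteq> B" "emeasure \<mu> (B - (\<Union>n. C n)) = 0"
proof -
  have "\<exists>C. compact C \<and> C \<subseteq> B \<and> emeasure \<mu> (B - C) < ennreal (1 / Suc n)" for n :: nat
    by (rule inner_approx[OF B]) simp
  then obtain C :: "nat \<Rightarrow> 'g set" where C: "\<And>n. compact (C n)" "\<And>n. C n \<subseteq> B"
    "\<And>n. emeasure \<mu> (B - C n) < ennreal (1 / Suc n)"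
    by metis
  have le: "emeasure \<mu> (B - (\<Union>n. C n)) \<le> ennreal (1 / Suc n)" for n
  proof -
    have "emeasure \<mu> (B - (\<Union>n. C n)) \<le> emeasure \<mu> (B - C n)"
      using B borel_compact_group[OF C(1)] by (intro emeasure_mono) auto
    then show ?thesis using C(3)[of n] by simp
  qed
  have "(\<lambda>n. ennreal (1 / Suc n)) \<longlonglongrightarrow> ennreal 0"
    by (intro tendsto_ennrealI LIMSEQ_divide_Suc)
  then have "emeasure \<mu> (B - (\<Union>n. C n)) \<le> ennreal 0"
    by (rule LIMSEQ_le_const) (use le in auto)
  then show thesis using that C by auto
qed

section \<open>Supports of integrable functions and reduction to \<sigma>-finite measures\<close>

lemma borel_measurable_integrable_haar:
  "integrable \<mu> (f :: 'g \<Rightarrow> real) \<Longrightarrow> f \<in> borel_measurable borel"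
  using borel_measurable_integrable by fastforce

text \<open>Markov's inequality bounds each level set. This carries results about sets of finite
  measure, such as inner regularity, over to the support of an integrable function.\<close>

lemma integrable_level_sets:
  fixes f :: "'g \<Rightarrow> real"
  assumes f: "integrable \<mu> f"
  obtains A :: "nat \<Rightarrow> 'g set" where "\<forall>n. A n \<in> sets borel \<and> emeasure \<mu> (A n) < \<infinity>"
    "{x. f x \<noteq> 0} = (\<Union>n. A n)"
proof (rule that[of "\<lambda>n. {x. 1 / Suc n \<le> norm (f x)}"])
  have [measurable]: "f \<in> borel_measurable borel" using f by (rule borel_measurable_integrable_haar)
  have "emeasure \<mu> {x. 1 / Suc n \<le> norm (f x)} < \<infinity>" for n
    using integral_Markov_inequality[OF integrable_norm[OF f], of "1 / Suc n"]
    by (auto intro: le_less_trans)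
  then show "\<forall>n. {x. 1 / Suc n \<le> norm (f x)} \<in> sets borel \<and> emeasure \<mu> {x. 1 / Suc n \<le> norm (f x)} < \<infinity>"
    by simp
  show "{x. f x \<noteq> 0} = (\<Union>n. {x. 1 / Suc n \<le> norm (f x)})"
  proof (intro set_eqI iffI)
    fix x assume "x \<in> {x. f x \<noteq> 0}"
    then have "0 < norm (f x)" by simp
    from reals_Archimedean[OF this] obtain n where "inverse (real (Suc n)) < norm (f x)" ..
    then show "x \<in> (\<Union>n. {x. 1 / Suc n \<le> norm (f x)})" by (auto simp: inverse_eq_divide intro: less_imp_le)
  next
    fix x assume "x \<in> (\<Union>n. {x. 1 / Suc n \<le> norm (f x)})"
    then obtain n where "1 / real (Suc n) \<le> norm (f x)" by auto
    then have "0 < norm (f x)" by (rule less_le_trans[rotated]) simp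
    then show "x \<in> {x. f x \<noteq> 0}" by simp
  qed
qed

text \<open>Each level set is exhausted by countably many compact sets up to a null set, and only
  countably many null sets arise.\<close>

lemma integrable_sigma_compact_support:
  fixes f :: "'g \<Rightarrow> real"
  assumes f: "integrable \<mu> f"
  obtains S where "sigma_compact S" "AE x in \<mu>. x \<notin> S \<longrightarrow> f x = 0"
proof -
  obtain A :: "nat \<Rightarrow> 'g set" where A': "\<forall>n. A n \<in> sets borel \<and> emeasure \<mu> (A n) < \<infinity>"
    and fA: "{x. f x \<noteq> 0} = (\<Union>n. A n)"
    using integrable_level_sets[OF f] .
  have A: "A n \<in> sets borel" and fin: "emeasure \<mu> (A n) < \<infinity>" for n using A' by auto
  have "\<exists>C. (\<forall>m::nat. compact (C m)) \<and> emeasure \<mu> (A n - (\<Union>m. C m)) = 0" for n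
    using sigma_compact_approx[OF A fin] by metis
  then obtain C where C: "\<And>n m::nat. compact (C n m)" "\<And>n. emeasure \<mu> (A n - (\<Union>m. C n m)) = 0"
    by metis
  show thesis
  proof (rule that[of "\<Union>n. \<Union>m. C n m"])
    show "sigma_compact (\<Union>n. \<Union>m. C n m)"
      by (intro sigma_compact_UN compact_imp_sigma_compact C)
    have "AE x in \<mu>. x \<notin> A n - (\<Union>m. C n m)" for n
      using A C(2)[of n] borel_compact_group[OF C(1)] by (intro AE_not_in null_setsI) auto
    then have "AE x in \<mu>. \<forall>n. x \<notin> A n - (\<Union>m. C n m)" by (simp add: AE_all_countable)
    then show "AE x in \<mu>. x \<notin> (\<Union>n. \<Union>m. C n m) \<longrightarrow> f x = 0"
    proof eventually_elim
      case (elim x)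
      show ?case
      proof (intro impI, rule ccontr)
        assume x: "x \<notin> (\<Union>n. \<Union>m. C n m)" "f x \<noteq> 0"
        then obtain n where "x \<in> A n" using fA by (metis (mono_tags, lifting) UN_E mem_Collect_eq)
        with elim x(1) show False by auto
      qed
    qed
  qed
qed

text \<open>The restriction of \<mu> to \<open>S\<close> is kept as a density on the whole group.
  The compact pieces of \<open>S\<close> have finite measure, and the complement of
  \<open>S\<close>, being null for the density, completes the cover.\<close>

lemma sigma_finite_density:
  assumes "sigma_compact S"
  shows "sigma_finite_measure (density \<mu> (indicator S))"
proof
  obtain K where K: "\<And>n::nat. compact (K n)" "S = (\<Union>n. K n)"
    using assms unfolding sigma_compact_def by auto
  have [measurable]: "K n \<in> sets borel" "S \<in> sets borel" for n
    using borel_compact_group K assms by auto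
  have "emeasure (density \<mu> (indicator S)) (K n) \<le> emeasure \<mu> (K n)" for n
    by (subst emeasure_restricted) (auto intro!: emeasure_mono)
  then have 1: "emeasure (density \<mu> (indicator S)) (K n) \<noteq> \<infinity>" for n
    using finite_on_compact[OF K(1)[of n]] by (auto simp: top.not_eq_extremum intro: le_less_trans)
  have 2: "emeasure (density \<mu> (indicator S)) (- S) = 0"
    by (subst emeasure_restricted) auto
  show "\<exists>A. countable A \<and> A \<subseteq> sets (density \<mu> (indicator S)) \<and> \<Union> A = space (density \<mu> (indicator S)) \<and>
        (\<forall>a\<in>A. emeasure (density \<mu> (indicator S)) a \<noteq> \<infinity>)"
    using 1 2 K(2) by (intro exI[of _ "insert (- S) (range K)"]) auto
qed

text \<open>The indicators turn both sides into iterated integrals for the \<sigma>-finite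
  restriction of \<mu> to \<open>H\<close>, where the classical theorem applies.\<close>

lemma tonelli:
  assumes H: "sigma_compact H" and F: "case_prod F \<in> borel_measurable (borel \<Otimes>\<^sub>M borel)"
  shows "(\<integral>\<^sup>+x. (\<integral>\<^sup>+y. F y x * indicator H y \<partial>\<mu>) * indicator H x \<partial>\<mu>)
       = (\<integral>\<^sup>+y. (\<integral>\<^sup>+x. F y x * indicator H x \<partial>\<mu>) * indicator H y \<partial>\<mu>)"
proof -
  have [measurable]: "H \<in> sets borel" using H by simp
  have [measurable]: "case_prod F \<in> borel_measurable (\<mu> \<Otimes>\<^sub>M \<mu>)"
    using F by (simp cong: measurable_cong_sets sets_pair_measure_cong)
  define \<nu> where "\<nu> = density \<mu> (indicator H)"
  have s[measurable_cong]: "sets \<nu> = sets \<mu>" by (simp add: \<nu>_def)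
  interpret S: sigma_finite_measure \<nu> unfolding \<nu>_def by (rule sigma_finite_density[OF H])
  interpret pair_sigma_finite \<nu> \<nu> ..
  have eq: "(\<integral>\<^sup>+x. f x \<partial>\<nu>) = (\<integral>\<^sup>+x. f x * indicator H x \<partial>\<mu>)" if "f \<in> borel_measurable \<mu>" for f
    unfolding \<nu>_def using that by (subst nn_integral_density) (auto simp: mult.commute)
  have F1: "(\<lambda>y. F y x) \<in> borel_measurable \<mu>" "(\<lambda>x. F y x) \<in> borel_measurable \<mu>" for x y by measurable
  have F': "case_prod F \<in> borel_measurable (\<nu> \<Otimes>\<^sub>M \<nu>)" by measurable
  have m1: "(\<lambda>x. \<integral>\<^sup>+y. F y x \<partial>\<nu>) \<in> borel_measurable \<mu>"
    by (rule S.borel_measurable_nn_integral[of "\<lambda>x y. F y x"]) measurable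
  have m2: "(\<lambda>y. \<integral>\<^sup>+x. F y x \<partial>\<nu>) \<in> borel_measurable \<mu>"
    by (rule S.borel_measurable_nn_integral[of F]) measurable
  show ?thesis
    using Fubini'[OF F'] unfolding eq[OF m1] eq[OF m2] unfolding eq[OF F1(1)] eq[OF F1(2)] .
qed

text \<open>
  In general the Borel \<open>\<sigma>\<close>-algebra of \<open>G \<times> G\<close> is strictly larger than the product \<open>\<sigma>\<close>-algebra, so
  \<open>(y, x) \<mapsto> g (- y + x)\<close> need not be product measurable for a Borel function \<open>g\<close>, and Tonelli's
  theorem does not apply to it. The predicates \<open>shift_measurable_set\<close> and \<open>shift_measurable\<close> exclude
  this problem; every integrable function has a shift measurable representative.
\<close>

definition shift_measurable_set :: "'g set \<Rightarrow> bool" where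
  "shift_measurable_set D \<longleftrightarrow> D \<in> sets borel \<and>
     (\<forall>K L. compact K \<longrightarrow> compact L \<longrightarrow> {(y, x). y \<in> K \<and> x \<in> L \<and> - y + x \<in> D} \<in> sets (borel \<Otimes>\<^sub>M borel))"

section \<open>Sets whose shifts are product measurable\<close>

lemma shift_measurable_set_UN:
  fixes D :: "nat \<Rightarrow> 'g set"
  assumes "\<And>n. shift_measurable_set (D n)"
  shows "shift_measurable_set (\<Union>n. D n)"
  unfolding shift_measurable_set_def
proof (intro conjI allI impI)
  show "(\<Union>n. D n) \<in> sets borel" using assms by (auto simp: shift_measurable_set_def)
  fix K L :: "'g set" assume "compact K" "compact L"
  then have "(\<Union>n. {(y, x). y \<in> K \<and> x \<in> L \<and> - y + x \<in> D n}) \<in> sets (borel \<Otimes>\<^sub>M borel)"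
    using assms by (intro sets.countable_UN) (auto simp: shift_measurable_set_def)
  also have "(\<Union>n. {(y, x). y \<in> K \<and> x \<in> L \<and> - y + x \<in> D n}) = {(y, x). y \<in> K \<and> x \<in> L \<and> - y + x \<in> (\<Union>n. D n)}"
    by auto
  finally show "{(y, x). y \<in> K \<and> x \<in> L \<and> - y + x \<in> (\<Union>n. D n)} \<in> sets (borel \<Otimes>\<^sub>M borel)" .
qed

lemma shift_measurable_set_INT:
  fixes D :: "nat \<Rightarrow> 'g set"
  assumes "\<And>n. shift_measurable_set (D n)"
  shows "shift_measurable_set (\<Inter>n. D n)"
  unfolding shift_measurable_set_def
proof (intro conjI allI impI)
  show "(\<Inter>n. D n) \<in> sets borel" using assms by (auto simp: shift_measurable_set_def)
  fix K L :: "'g set" assume "compact K" "compact L"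
  then have "(\<Inter>n. {(y, x). y \<in> K \<and> x \<in> L \<and> - y + x \<in> D n}) \<in> sets (borel \<Otimes>\<^sub>M borel)"
    using assms by (intro sets.countable_INT) (auto simp: shift_measurable_set_def)
  also have "(\<Inter>n. {(y, x). y \<in> K \<and> x \<in> L \<and> - y + x \<in> D n}) = {(y, x). y \<in> K \<and> x \<in> L \<and> - y + x \<in> (\<Inter>n. D n)}"
    by auto
  finally show "{(y, x). y \<in> K \<and> x \<in> L \<and> - y + x \<in> (\<Inter>n. D n)} \<in> sets (borel \<Otimes>\<^sub>M borel)" .
qed

text \<open>By the tube lemma, \<open>\<phi> (- y + x)\<close> varies little for \<open>y\<close>
  near a given point, uniformly for \<open>x\<close> in the compact set \<open>L\<close>. Finitely
  many such neighbourhoods cover \<open>K\<close>. Freezing \<open>y\<close> at their centres gives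
  finite sums of products of functions of one variable, which are product measurable and approximate
  the function uniformly.\<close>

lemma continuous_shift_measurable:
  fixes \<phi> :: "'g \<Rightarrow> real"
  assumes \<phi>: "continuous_on UNIV \<phi>" and K: "compact K" and L: "compact L"
  shows "(\<lambda>(y, x). \<phi> (- y + x) * indicator K y * indicator L x) \<in> borel_measurable (borel \<Otimes>\<^sub>M borel)"
proof -
  have K': "K \<in> sets borel" "L \<in> sets borel" using K L borel_compact_group by auto
  have \<phi>m: "\<phi> \<in> borel_measurable borel" using \<phi> by (rule borel_measurable_continuous_onI)
  have approx: "\<exists>G \<in> borel_measurable (borel \<Otimes>\<^sub>M borel). \<forall>y x. \<bar>G (y, x) - \<phi> (- y + x) * indicator K y * indicator L x\<bar> \<le> e"
    if e: "e > 0" for e :: real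
  proof -
    have "\<exists>U. open U \<and> y0 \<in> U \<and> (\<forall>y\<in>U. \<forall>x\<in>L. \<bar>\<phi> (- y + x) - \<phi> (- y0 + x)\<bar> < e)" for y0
    proof -
      define W where "W = {p :: 'g \<times> 'g. \<bar>\<phi> (- fst p + snd p) - \<phi> (- y0 + snd p)\<bar> < e}"
      have c: "continuous_on UNIV (\<lambda>p :: 'g \<times> 'g. \<bar>\<phi> (- fst p + snd p) - \<phi> (- y0 + snd p)\<bar>)"
        by (intro continuous_intros continuous_on_compose2[OF \<phi>]) auto
      have "open W" unfolding W_def by (rule open_Collect_less[OF c]) (intro continuous_intros)
      moreover have "{y0} \<times> L \<subseteq> W" using e by (auto simp: W_def)
      ultimately obtain U where "open U" "{y0} \<subseteq> U" "U \<times> L \<subseteq> W"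
        using Elementary_Topology.tube_lemma[OF L, of W y0] by auto
      then show ?thesis by (intro exI[of _ U]) (auto simp: W_def)
    qed
    then obtain U where U: "\<And>y0. open (U y0)" "\<And>y0. y0 \<in> U y0"
      "\<And>y0 y x. y \<in> U y0 \<Longrightarrow> x \<in> L \<Longrightarrow> \<bar>\<phi> (- y + x) - \<phi> (- y0 + x)\<bar> < e" by metis
    obtain T where T: "T \<subseteq> K" "finite T" "K \<subseteq> (\<Union>t\<in>T. U t)"
      using compactE_image[OF K, of K U] U by (metis UN_iff subsetI)
    obtain ts where ts: "set ts = T" using finite_list[OF T(2)] by auto
    \<comment> \<open>Disjoint pieces of \<open>K\<close>: each point of \<open>K\<close> selects
      the first neighbourhood in the list that contains it, so at most one term of \<open>G\<close>
      survives.\<close>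
    define V where "V i = (U (ts ! i) - (\<Union>j<i. U (ts ! j))) \<inter> K" for i
    define G where "G = (\<lambda>(y, x). \<Sum>i<length ts. \<phi> (- (ts ! i) + x) * indicator (V i) y * indicator L x)"
    have [measurable]: "V i \<in> sets borel" for i unfolding V_def using K' U by auto
    have "G \<in> borel_measurable (borel \<Otimes>\<^sub>M borel)"
      unfolding G_def using \<phi>m K' by measurable
    moreover have "\<bar>G (y, x) - \<phi> (- y + x) * indicator K y * indicator L x\<bar> \<le> e" for y x
    proof (cases "y \<in> K \<and> x \<in> L")
      case False
      then have "G (y, x) = 0" unfolding G_def by (auto simp: V_def indicator_def intro!: sum.neutral)
      then show ?thesis using False e by auto
    next
      case True
      define i where "i = (LEAST i. i < length ts \<and> y \<in> U (ts ! i))"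
      have "\<exists>i. i < length ts \<and> y \<in> U (ts ! i)"
        using T(3) True ts by (auto simp: in_set_conv_nth) (metis UN_E in_set_conv_nth subsetD)
      then have i: "i < length ts" "y \<in> U (ts ! i)" unfolding i_def by (auto dest!: LeastI_ex)
      have il: "y \<notin> U (ts ! j)" if "j < i" for j
        using not_less_Least[of j "\<lambda>i. i < length ts \<and> y \<in> U (ts ! i)"] that i unfolding i_def by auto
      have "indicator (V j) y = (if j = i then 1 else 0 :: real)" if "j < length ts" for j
        using i il True by (cases j i rule: linorder_cases) (auto simp: V_def indicator_def)
      then have "G (y, x) = (\<Sum>j<length ts. if j = i then \<phi> (- (ts ! i) + x) else 0)"
        unfolding G_def prod.case using True by (intro sum.cong) simp_all
      also have "\<dots> = \<phi> (- (ts ! i) + x)" using i by simp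
      finally show ?thesis using U(3)[OF i(2), of x] True by simp
    qed
    ultimately show ?thesis by blast
  qed
  obtain G where G: "\<And>n::nat. G n \<in> borel_measurable (borel \<Otimes>\<^sub>M borel)"
    "\<And>n y x. \<bar>G n (y, x) - \<phi> (- y + x) * indicator K y * indicator L x\<bar> \<le> 1 / Suc n"
  proof -
    have "\<forall>n. \<exists>G. G \<in> borel_measurable (borel \<Otimes>\<^sub>M borel) \<and>
      (\<forall>y x. \<bar>G (y, x) - \<phi> (- y + x) * indicator K y * indicator L x\<bar> \<le> 1 / Suc n)"
    proof
      fix n :: nat
      have "0 < 1 / real (Suc n)" by simp
      from approx[OF this] show "\<exists>G. G \<in> borel_measurable (borel \<Otimes>\<^sub>M borel) \<and>
        (\<forall>y x. \<bar>G (y, x) - \<phi> (- y + x) * indicator K y * indicator L x\<bar> \<le> 1 / Suc n)"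
        by (simp only: Bex_def)
    qed
    from choice[OF this] obtain G where "\<forall>n. G n \<in> borel_measurable (borel \<Otimes>\<^sub>M borel) \<and>
      (\<forall>y x. \<bar>G n (y, x) - \<phi> (- y + x) * indicator K y * indicator L x\<bar> \<le> 1 / Suc n)" ..
    then show thesis by (intro that[of G]) simp_all
  qed
  show ?thesis
  proof (rule borel_measurable_LIMSEQ_real[OF _ G(1)])
    fix p :: "'g \<times> 'g"
    obtain y x where p: "p = (y, x)" by (cases p)
    have "(\<lambda>n. G n (y, x) - \<phi> (- y + x) * indicator K y * indicator L x) \<longlonglongrightarrow> 0"
      by (rule Lim_null_comparison[of _ "\<lambda>n. 1 / Suc n"]) (use G(2) LIMSEQ_divide_Suc in auto)
    then show "(\<lambda>n. G n p) \<longlonglongrightarrow> (case p of (y, x) \<Rightarrow> \<phi> (- y + x) * indicator K y * indicator L x)"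
      unfolding p by (simp add: LIM_zero_iff)
  qed
qed

lemma shift_measurable_set_continuous:
  fixes \<phi> :: "'g \<Rightarrow> real"
  assumes \<phi>: "continuous_on UNIV \<phi>"
  shows "shift_measurable_set {x. 1 \<le> \<phi> x}"
  unfolding shift_measurable_set_def
proof (intro conjI allI impI)
  have [measurable]: "\<phi> \<in> borel_measurable borel" using \<phi> by (rule borel_measurable_continuous_onI)
  show "{x. 1 \<le> \<phi> x} \<in> sets borel" by measurable
  fix K L :: "'g set" assume K: "compact K" "compact L"
  let ?F = "\<lambda>(y, x). \<phi> (- y + x) * indicator K y * indicator L x"
  have "{p \<in> space (borel \<Otimes>\<^sub>M borel). 1 \<le> ?F p} \<in> sets (borel \<Otimes>\<^sub>M borel)"
    using continuous_shift_measurable[OF \<phi> K] by measurable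
  \<comment> \<open>Outside the box of \<open>K\<close> and \<open>L\<close> the function
    \<open>?F\<close> is 0, hence below the threshold 1.\<close>
  also have "{p \<in> space (borel \<Otimes>\<^sub>M borel). 1 \<le> ?F p} = {(y, x). y \<in> K \<and> x \<in> L \<and> - y + x \<in> {x. 1 \<le> \<phi> x}}"
    by (auto simp: space_pair_measure split: split_indicator_asm split_indicator)
  finally show "{(y, x). y \<in> K \<and> x \<in> L \<and> - y + x \<in> {x. 1 \<le> \<phi> x}} \<in> sets (borel \<Otimes>\<^sub>M borel)" .
qed

text \<open>A locally compact Hausdorff space is completely regular, so a continuous function
  separates \<open>C\<close> from the complement of an open set of nearly the same measure. Its zero
  set is shift measurable and lies between the two; a countable intersection of such sets exceeds
  \<open>C\<close> by a null set only.\<close>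

lemma compact_shift_measurable_hull:
  assumes C: "compact C"
  obtains D where "shift_measurable_set D" "C \<subseteq> D" "emeasure \<mu> (D - C) = 0"
proof -
  have bC: "C \<in> sets borel" using C by (rule borel_compact_group)
  have crs: "completely_regular_space (euclidean :: 'g topology)"
    using locally_compact_regular_imp_completely_regular_space[OF locally_compact]
      Hausdorff_euclidean_t2 by blast
  have "\<exists>D. shift_measurable_set D \<and> C \<subseteq> D \<and> emeasure \<mu> (D - C) \<le> ennreal (1 / Suc n)" for n :: nat
  proof -
    obtain V where V: "open V" "C \<subseteq> V" "emeasure \<mu> (V - C) < ennreal (1 / Suc n)"
      using outer_approx[OF bC finite_on_compact[OF C], of "ennreal (1 / Suc n)"] by auto
    obtain \<phi> where \<phi>: "continuous_map euclidean (top_of_set {0..1::real}) \<phi>" "\<phi> ` C \<subseteq> {0}" "\<phi> ` (- V) \<subseteq> {1}"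
      using Urysohn_completely_regular_closed_compact[of 0 1 "euclidean :: 'g topology" "- V" C] crs V C
      by (auto simp: disjnt_def)
    have "continuous_on UNIV \<phi>" using \<phi>(1) by (simp add: continuous_map_in_subtopology)
    then have c: "continuous_on UNIV (\<lambda>x. 1 - \<phi> x)" by (intro continuous_intros)
    \<comment> \<open>This is the zero set of \<phi>, written as a superlevel set to match
      \<open>shift_measurable_set_continuous\<close>.\<close>
    let ?D = "{x. 1 \<le> 1 - \<phi> x}"
    have "?D \<subseteq> V" using \<phi>(3) by force
    then have "emeasure \<mu> (?D - C) \<le> emeasure \<mu> (V - C)"
      using V bC by (intro emeasure_mono) auto
    then show ?thesis using V(3) shift_measurable_set_continuous[OF c] \<phi>(2) by (intro exI[of _ ?D]) auto
  qed
  then obtain D where D: "\<And>n::nat. shift_measurable_set (D n)" "\<And>n. C \<subseteq> D n" "\<And>n. emeasure \<mu> (D n - C) \<le> ennreal (1 / Suc n)"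
    by metis
  have "emeasure \<mu> ((\<Inter>n. D n) - C) \<le> ennreal (1 / Suc n)" for n
    using D(1) bC by (intro order.trans[OF emeasure_mono D(3)]) (auto simp: shift_measurable_set_def)
  moreover have "(\<lambda>n. ennreal (1 / Suc n)) \<longlonglongrightarrow> ennreal 0"
    by (intro tendsto_ennrealI LIMSEQ_divide_Suc)
  ultimately have "emeasure \<mu> ((\<Inter>n. D n) - C) \<le> ennreal 0"
    by (intro LIMSEQ_le_const) auto
  then show thesis using D(2) shift_measurable_set_INT[OF D(1)] by (intro that[of "\<Inter>n. D n"]) auto
qed

text \<open>
  This makes \<open>convolution\<close> depend on the classes of its arguments everywhere, not just almost
  everywhere. If the set had positive measure, it would contain a compact \<open>C\<close> of positive measure
  whose reflection \<open>T\<close> is null, and Tonelli's theorem for \<open>(y, z) \<mapsto> - y + z \<in> D\<close>, where \<open>D\<close> is a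
  null hull of \<open>T\<close>, would give \<open>0 = \<mu>(C)\<^sup>2\<close>.
\<close>

lemma null_reflect:
  assumes B: "B \<in> sets borel" "emeasure \<mu> B < \<infinity>" and N: "N \<in> sets borel" "emeasure \<mu> N = 0"
  shows "emeasure \<mu> {y \<in> B. - y + x \<in> N} = 0"
proof (rule ccontr)
  let ?A = "{y \<in> B. - y + x \<in> N}"
  assume pos: "emeasure \<mu> ?A \<noteq> 0"
  have A: "?A \<in> sets borel"
  proof -
    have "?A = B \<inter> ((\<lambda>y. - y + x) -` N \<inter> space borel)" by auto
    also have "\<dots> \<in> sets borel" using B N by (intro sets.Int measurable_sets[OF measurable_translate(2)])
    finally show ?thesis .
  qed
  have "emeasure \<mu> ?A < \<infinity>"
    using B by (intro le_less_trans[OF emeasure_mono[of ?A B] B(2)]) auto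
  \<comment> \<open>Taking the measure of \<open>?A\<close> itself as the admissible error rules out
    a null \<open>C\<close>.\<close>
  from inner_approx[OF A this, of "emeasure \<mu> ?A"] pos
  obtain C where C: "compact C" "C \<subseteq> ?A" "emeasure \<mu> (?A - C) < emeasure \<mu> ?A"
    by (auto simp: zero_less_iff_neq_zero)
  have bC[measurable]: "C \<in> sets borel" using C by (simp add: borel_compact_group)
  have posC: "emeasure \<mu> C \<noteq> 0"
  proof
    assume "emeasure \<mu> C = 0"
    then have "emeasure \<mu> (?A - C) = emeasure \<mu> ?A"
      using A bC by (intro emeasure_Diff_null_set null_setsI) auto
    then show False using C by simp
  qed
  define T where "T = (\<lambda>y. - y + x) ` C"
  have T: "compact T" unfolding T_def by (rule compact_continuous_image[OF _ C(1)]) (intro continuous_intros)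
  have "T \<subseteq> N" using C by (auto simp: T_def)
  then have "emeasure \<mu> T = 0" using N emeasure_mono[of T N \<mu>] by auto
  moreover obtain D where D: "shift_measurable_set D" "T \<subseteq> D" "emeasure \<mu> (D - T) = 0" using compact_shift_measurable_hull[OF T] .
  moreover have bD: "D \<in> sets borel" using D by (simp add: shift_measurable_set_def)
  moreover have bT: "T \<in> sets borel" using T by (simp add: borel_compact_group)
  ultimately have nD: "emeasure \<mu> D = 0"
    using emeasure_Un_null_set[of "D - T" \<mu> T] by (auto simp: null_sets_def Un_absorb2)
  \<comment> \<open>\<open>K\<close> consists of the points y = (z - x) + c with \<open>z\<close>
    and \<open>c\<close> in \<open>C\<close>; for these, - y + z = - c + x lies in
    \<open>T\<close>.\<close>
  define K where "K = (\<lambda>(z, c). z + c) ` ((\<lambda>z. z - x) ` C \<times> C)"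
  have K: "compact K" unfolding K_def
    by (intro compact_sumset(2) C compact_continuous_image)
       (simp add: diff_conv_add_uminus del: add_uminus_conv_diff, intro continuous_intros)
  define Q where "Q = {(y, z). y \<in> K \<and> z \<in> C \<and> - y + z \<in> D}"
  have Q: "Q \<in> sets (borel \<Otimes>\<^sub>M borel)" using D(1) K C unfolding shift_measurable_set_def Q_def by blast
  \<comment> \<open>\<open>tonelli\<close> restricts both variables to the same set, so the ranges
    of \<open>y\<close> and \<open>z\<close> are united.\<close>
  have H: "sigma_compact (K \<union> C)" using K C by (simp add: compact_imp_sigma_compact compact_Un)
  define F where "F = (\<lambda>y z. indicator Q (y, z) :: ennreal)"
  have Fm: "case_prod F \<in> borel_measurable (borel \<Otimes>\<^sub>M borel)"
    using Q by (simp add: F_def)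
  \<comment> \<open>For fixed \<open>y\<close>, the section of \<open>Q\<close> lies in the
    translate y + D of a null set.\<close>
  have "(\<integral>\<^sup>+z. F y z * indicator (K \<union> C) z \<partial>\<mu>) = 0" for y
  proof -
    have "(\<integral>\<^sup>+z. F y z * indicator (K \<union> C) z \<partial>\<mu>) \<le> (\<integral>\<^sup>+z. indicator ((\<lambda>d. y + d) ` D) z \<partial>\<mu>)"
    proof (intro nn_integral_mono)
      fix z
      have "z = y + (- y + z)" by (simp add: add.assoc[symmetric])
      then have "z \<in> (\<lambda>d. y + d) ` D" if "- y + z \<in> D" using that by blast
      then show "F y z * indicator (K \<union> C) z \<le> indicator ((\<lambda>d. y + d) ` D) z"
        by (auto simp: F_def Q_def indicator_def)
    qed
    also have "\<dots> = emeasure \<mu> ((\<lambda>d. y + d) ` D)"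
    proof (rule nn_integral_indicator)
      have "(\<lambda>d. y + d) ` D = (\<lambda>d. - y + d) -` D \<inter> space borel"
        by (force simp: add.assoc[symmetric] image_iff)
      then show "(\<lambda>d. y + d) ` D \<in> sets \<mu>"
        using measurable_sets[OF measurable_translate(1)[of "- y"] bD] by simp
    qed
    also have "\<dots> = 0" using emeasure_translate[OF bD] nD by simp
    finally show ?thesis by simp
  qed
  then have "(\<integral>\<^sup>+y. (\<integral>\<^sup>+z. F y z * indicator (K \<union> C) z \<partial>\<mu>) * indicator (K \<union> C) y \<partial>\<mu>) = 0"
    by simp
  then have z: "(\<integral>\<^sup>+z. (\<integral>\<^sup>+y. F y z * indicator (K \<union> C) y \<partial>\<mu>) * indicator (K \<union> C) z \<partial>\<mu>) = 0"
    using tonelli[OF H Fm] by simp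
  \<comment> \<open>For fixed \<open>z\<close> in \<open>C\<close>, the section of \<open>Q\<close>
    contains the translate (z - x) + C, which has the measure of \<open>C\<close>.\<close>
  have ge: "emeasure \<mu> C * indicator C z \<le> (\<integral>\<^sup>+y. F y z * indicator (K \<union> C) y \<partial>\<mu>) * indicator (K \<union> C) z" for z
  proof (cases "z \<in> C")
    case True
    have "emeasure \<mu> C = emeasure \<mu> ((\<lambda>c. (z - x) + c) ` C)"
      by (rule emeasure_translate[symmetric, OF bC])
    also have "\<dots> = (\<integral>\<^sup>+y. indicator ((\<lambda>c. (z - x) + c) ` C) y \<partial>\<mu>)"
    proof (rule nn_integral_indicator[symmetric])
      have "compact ((\<lambda>c. (z - x) + c) ` C)"
        by (rule compact_continuous_image[OF _ C(1)]) (intro continuous_intros)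
      then show "(\<lambda>c. (z - x) + c) ` C \<in> sets \<mu>" by (simp add: borel_compact_group)
    qed
    also have "\<dots> \<le> (\<integral>\<^sup>+y. F y z * indicator (K \<union> C) y \<partial>\<mu>)"
    proof (rule nn_integral_mono)
      fix y
      have "F y z = 1 \<and> y \<in> K" if c: "c \<in> C" "y = (z - x) + c" for c
      proof -
        have "y \<in> K" using True c unfolding K_def by (intro image_eqI[of _ _ "(z - x, c)"]) auto
        moreover have "- y + z = - c + x" using c by (simp add: minus_add diff_conv_add_uminus add.assoc del: add_uminus_conv_diff)
        then have "- y + z \<in> D" using c D(2) by (auto simp: T_def)
        ultimately show ?thesis using True by (simp add: F_def Q_def)
      qed
      then show "indicator ((\<lambda>c. (z - x) + c) ` C) y \<le> F y z * indicator (K \<union> C) y"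
        by (auto simp: indicator_def split: if_splits)
    qed
    finally show ?thesis using True by simp
  qed simp
  have "emeasure \<mu> C * emeasure \<mu> C = (\<integral>\<^sup>+z. emeasure \<mu> C * indicator C z \<partial>\<mu>)"
    by (subst nn_integral_cmult_indicator) auto
  also have "\<dots> \<le> 0" unfolding z[symmetric] by (rule nn_integral_mono) (rule ge)
  finally show False using posC by simp
qed

section \<open>Shift measurable representatives of integrable functions\<close>

definition shift_measurable :: "('g \<Rightarrow> real) \<Rightarrow> bool" where
  "shift_measurable g \<longleftrightarrow> g \<in> borel_measurable borel \<and> (\<forall>K L. compact K \<longrightarrow> compact L \<longrightarrow>
     (\<lambda>(y, x). g (- y + x) * indicator K y * indicator L x) \<in> borel_measurable (borel \<Otimes>\<^sub>M borel))"

lemma borel_measurable_shift_measurable: "shift_measurable g \<Longrightarrow> g \<in> borel_measurable borel"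
  unfolding shift_measurable_def by blast

lemma shift_measurable_indicator:
  assumes "shift_measurable_set D"
  shows "shift_measurable (indicator D)"
  unfolding shift_measurable_def
proof (intro conjI allI impI)
  show "indicat_real D \<in> borel_measurable borel" using assms unfolding shift_measurable_set_def by (intro borel_measurable_indicator) blast
  fix K L :: "'g set" assume "compact K" "compact L"
  then have "{(y, x). y \<in> K \<and> x \<in> L \<and> - y + x \<in> D} \<in> sets (borel \<Otimes>\<^sub>M borel)"
    using assms unfolding shift_measurable_set_def by blast
  then have "indicat_real {(y, x). y \<in> K \<and> x \<in> L \<and> - y + x \<in> D} \<in> borel_measurable (borel \<Otimes>\<^sub>M borel)"
    by simp
  also have "indicat_real {(y, x). y \<in> K \<and> x \<in> L \<and> - y + x \<in> D}
    = (\<lambda>(y, x). indicat_real D (- y + x) * indicator K y * indicator L x)"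
    by (auto simp: fun_eq_iff split: split_indicator)
  finally show "(\<lambda>(y, x). indicat_real D (- y + x) * indicator K y * indicator L x) \<in> borel_measurable (borel \<Otimes>\<^sub>M borel)" .
qed

lemma shift_measurable_cmult:
  assumes "shift_measurable f"
  shows "shift_measurable (\<lambda>x. c * f x)"
  unfolding shift_measurable_def
proof (intro conjI allI impI)
  show "(\<lambda>x. c * f x) \<in> borel_measurable borel" using assms[THEN borel_measurable_shift_measurable] by measurable
  fix K L :: "'g set" assume "compact K" "compact L"
  then have "(\<lambda>(y, x). f (- y + x) * indicator K y * indicator L x) \<in> borel_measurable (borel \<Otimes>\<^sub>M borel)"
    using assms unfolding shift_measurable_def by blast
  then have "(\<lambda>p. c * (\<lambda>(y, x). f (- y + x) * indicator K y * indicator L x) p) \<in> borel_measurable (borel \<Otimes>\<^sub>M borel)"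
    by (rule borel_measurable_times[OF borel_measurable_const])
  then show "(\<lambda>(y, x). c * f (- y + x) * indicator K y * indicator L x) \<in> borel_measurable (borel \<Otimes>\<^sub>M borel)"
    by (simp add: case_prod_beta mult.assoc)
qed

lemma shift_measurable_add:
  assumes "shift_measurable f" "shift_measurable g"
  shows "shift_measurable (\<lambda>x. f x + g x)"
  unfolding shift_measurable_def
proof (intro conjI allI impI)
  show "(\<lambda>x. f x + g x) \<in> borel_measurable borel" using assms[THEN borel_measurable_shift_measurable] by measurable
  fix K L :: "'g set" assume "compact K" "compact L"
  then have "(\<lambda>(y, x). f (- y + x) * indicator K y * indicator L x) \<in> borel_measurable (borel \<Otimes>\<^sub>M borel)"
    "(\<lambda>(y, x). g (- y + x) * indicator K y * indicator L x) \<in> borel_measurable (borel \<Otimes>\<^sub>M borel)"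
    using assms unfolding shift_measurable_def by blast+
  from borel_measurable_add[OF this]
  show "(\<lambda>(y, x). (f (- y + x) + g (- y + x)) * indicator K y * indicator L x) \<in> borel_measurable (borel \<Otimes>\<^sub>M borel)"
    by (simp add: case_prod_beta distrib_right)
qed

lemma shift_measurable_lim:
  assumes "\<And>i. shift_measurable (s i)"
  shows "shift_measurable (\<lambda>x. lim (\<lambda>i. s i x))"
  unfolding shift_measurable_def
proof (intro conjI allI impI)
  show "(\<lambda>x. lim (\<lambda>i. s i x)) \<in> borel_measurable borel" using assms[THEN borel_measurable_shift_measurable] by measurable
  fix K L :: "'g set" assume KL: "compact K" "compact L"
  let ?F = "\<lambda>i (y, x). s i (- y + x) * indicator K y * indicator L x"
  have [measurable]: "?F i \<in> borel_measurable (borel \<Otimes>\<^sub>M borel)" for i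
    using assms KL unfolding shift_measurable_def by blast
  have [measurable]: "K \<in> sets borel" "L \<in> sets borel" using KL borel_compact_group by auto
  \<comment> \<open>On the box both sequences coincide, so their \<open>lim\<close> agrees even
    where there is no convergence; the outer indicators give 0 elsewhere.\<close>
  have "(\<lambda>p. lim (\<lambda>i. ?F i p) * indicator K (fst p) * indicator L (snd p)) \<in> borel_measurable (borel \<Otimes>\<^sub>M borel)"
    by measurable
  also have "(\<lambda>p. lim (\<lambda>i. ?F i p) * indicator K (fst p) * indicator L (snd p))
    = (\<lambda>(y, x). lim (\<lambda>i. s i (- y + x)) * indicator K y * indicator L x)"
    by (auto simp: fun_eq_iff split: split_indicator)
  finally show "(\<lambda>(y, x). lim (\<lambda>i. s i (- y + x)) * indicator K y * indicator L x) \<in> borel_measurable (borel \<Otimes>\<^sub>M borel)" .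
qed

text \<open>Induction over integrable functions. A set of finite measure is, up to a null set, a
  union of countably many compact sets, and these are replaced by their hulls. In the limit case the
  modified functions converge only almost everywhere, so the total function \<open>lim\<close> is
  used.\<close>

lemma integrable_AE_eq_shift_measurable:
  fixes g :: "'g \<Rightarrow> real"
  assumes "integrable \<mu> g"
  shows "\<exists>g'. shift_measurable g' \<and> (AE x in \<mu>. g' x = g x)"
  using assms
proof (induction rule: integrable_induct)
  case (base A c)
  then have A: "A \<in> sets borel" "emeasure \<mu> A < \<infinity>" by auto
  obtain C :: "nat \<Rightarrow> 'g set" where C: "\<And>n. compact (C n)" "\<And>n. C n \<subseteq> A" "emeasure \<mu> (A - (\<Union>n. C n)) = 0"
    using sigma_compact_approx[OF A] by blast
  have "\<exists>D. shift_measurable_set D \<and> C n \<subseteq> D \<and> emeasure \<mu> (D - C n) = 0" for n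
    using compact_shift_measurable_hull[OF C(1)[of n]] by blast
  then obtain D where D: "\<And>n. shift_measurable_set (D n)" "\<And>n. C n \<subseteq> D n" "\<And>n. emeasure \<mu> (D n - C n) = 0"
    by metis
  have [measurable]: "C n \<in> sets borel" "D n \<in> sets borel" for n
    using borel_compact_group[OF C(1)] D(1) by (auto simp: shift_measurable_set_def)
  have "AE x in \<mu>. x \<notin> D n - C n" for n
    by (rule AE_not_in, rule null_setsI[OF D(3)]) simp
  then have "AE x in \<mu>. \<forall>n. x \<notin> D n - C n" by (simp add: AE_all_countable)
  moreover have "AE x in \<mu>. x \<notin> A - (\<Union>n. C n)"
    using A by (intro AE_not_in null_setsI[OF C(3)]) auto
  ultimately have "AE x in \<mu>. c * indicator (\<Union>n. D n) x = indicator A x *\<^sub>R c"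
  proof eventually_elim
    case (elim x)
    then have "x \<in> (\<Union>n. D n) \<longleftrightarrow> x \<in> A" using C(2) D(2) by blast
    then show ?case by (simp add: indicator_def)
  qed
  then show ?case
    by (intro exI[of _ "\<lambda>x. c * indicator (\<Union>n. D n) x"] conjI shift_measurable_cmult shift_measurable_indicator shift_measurable_set_UN D(1))
next
  case (add f g)
  then obtain f' g' where *: "shift_measurable f'" "AE x in \<mu>. f' x = f x" "shift_measurable g'" "AE x in \<mu>. g' x = g x" by blast
  show ?case
    using *(2,4) by (intro exI[of _ "\<lambda>x. f' x + g' x"] conjI shift_measurable_add *) auto
next
  case (lim f s)
  then obtain s' where s': "\<And>i. shift_measurable (s' i)" "\<And>i. AE x in \<mu>. s' i x = s i x" by metis
  have "AE x in \<mu>. \<forall>i. s' i x = s i x" using s'(2) by (simp add: AE_all_countable)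
  then have "AE x in \<mu>. lim (\<lambda>i. s' i x) = f x"
    by eventually_elim (use lim(2) in \<open>auto intro: limI\<close>)
  then show ?case by (intro exI[of _ "\<lambda>x. lim (\<lambda>i. s' i x)"] conjI shift_measurable_lim s'(1))
qed

lemma shift_measurable_sigma_compact:
  assumes g: "shift_measurable g" and H: "sigma_compact H"
  shows "(\<lambda>(y, x). g (- y + x) * indicator H y * indicator H x) \<in> borel_measurable (borel \<Otimes>\<^sub>M borel)"
proof -
  obtain K where K: "\<And>n::nat. compact (K n)" "H = (\<Union>n. K n)"
    using H unfolding sigma_compact_def by auto
  define L where "L n = (\<Union>i\<le>n. K i)" for n
  have L: "compact (L n)" for n unfolding L_def using K by (intro compact_UN) auto
  show ?thesis
  proof (rule borel_measurable_LIMSEQ_real)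
    show "(\<lambda>(y, x). g (- y + x) * indicator (L n) y * indicator (L n) x) \<in> borel_measurable (borel \<Otimes>\<^sub>M borel)" for n
      using g L unfolding shift_measurable_def by blast
    fix p :: "'g \<times> 'g"
    obtain y x where p: "p = (y, x)" by (cases p)
    have ind: "(\<lambda>n. indicat_real (L n) z) \<longlonglongrightarrow> indicator H z" for z
    proof -
      have "incseq L" unfolding L_def incseq_def by force
      moreover have "(\<Union>n. L n) = H" unfolding L_def K(2) by auto
      ultimately show ?thesis using LIMSEQ_indicator_incseq[of L z] by simp
    qed
    show "(\<lambda>n. case p of (y, x) \<Rightarrow> g (- y + x) * indicator (L n) y * indicator (L n) x)
      \<longlonglongrightarrow> (case p of (y, x) \<Rightarrow> g (- y + x) * indicator H y * indicator H x)"
      unfolding p prod.case by (intro tendsto_intros ind)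
  qed
qed

text \<open>The support of \<open>f\<close> is a countable union of sets of finite measure, and
  \<open>null_reflect\<close> applies to each of them.\<close>

lemma AE_reflect:
  fixes f :: "'g \<Rightarrow> real"
  assumes f: "integrable \<mu> f" and P: "AE x in \<mu>. P x"
  shows "AE y in \<mu>. f y \<noteq> 0 \<longrightarrow> P (- y + x)"
proof -
  obtain N where N: "{x. \<not> P x} \<subseteq> N" "emeasure \<mu> N = 0" "N \<in> sets borel"
    using AE_E[OF P] by auto
  obtain A :: "nat \<Rightarrow> 'g set" where A': "\<forall>n. A n \<in> sets borel \<and> emeasure \<mu> (A n) < \<infinity>"
    and fA: "{x. f x \<noteq> 0} = (\<Union>n. A n)"
    using integrable_level_sets[OF f] .
  have A: "A n \<in> sets borel" and fin: "emeasure \<mu> (A n) < \<infinity>" for n using A' by auto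
  have "AE y in \<mu>. y \<notin> {y \<in> A n. - y + x \<in> N}" for n
  proof (intro AE_not_in null_setsI null_reflect[OF A fin N(3,2)])
    have "{y \<in> A n. - y + x \<in> N} = A n \<inter> ((\<lambda>y. - y + x) -` N \<inter> space borel)" by auto
    also have "\<dots> \<in> sets borel" using A N by (intro sets.Int measurable_sets[OF measurable_translate(2)])
    finally show "{y \<in> A n. - y + x \<in> N} \<in> sets \<mu>" by simp
  qed
  then have "AE y in \<mu>. \<forall>n. y \<notin> {y \<in> A n. - y + x \<in> N}" unfolding AE_all_countable by blast
  then show ?thesis
  proof eventually_elim
    case (elim y)
    show ?case
    proof
      assume "f y \<noteq> 0"
      then obtain n where "y \<in> A n" using fA by (metis (mono_tags, lifting) UN_E mem_Collect_eq)
      with elim N(1) show "P (- y + x)" by auto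
    qed
  qed
qed

text \<open>Where \<open>f\<close> is nonzero, \<open>AE_reflect\<close> carries the equality of
  \<open>g\<close> and \<open>g'\<close> over to the points - y + x; where \<open>f\<close>
  vanishes, almost everywhere both products are 0. The argument works for every
  \<open>x\<close>.\<close>

lemma convolution_cong_AE:
  assumes f: "integrable \<mu> f" "integrable \<mu> f'" "AE x in \<mu>. f x = f' x"
    and g: "g \<in> borel_measurable borel" "g' \<in> borel_measurable borel" "AE x in \<mu>. g x = g' x"
  shows "AE y in \<mu>. f y * g (- y + x) = f' y * g' (- y + x)"
    "convolution \<mu> f g = convolution \<mu> f' g'"
proof -
  note [measurable] = f(1,2)[THEN borel_measurable_integrable_haar] g(1,2)
  show ae: "AE y in \<mu>. f y * g (- y + x) = f' y * g' (- y + x)" for x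
    using AE_reflect[OF f(1) g(3), of x] f(3) by eventually_elim auto
  show "convolution \<mu> f g = convolution \<mu> f' g'"
    unfolding convolution_def
    by (intro ext integral_cong_AE ae) (measurable)
qed

section \<open>Convolution of integrable functions\<close>

lemma integral_translate:
  fixes f :: "'g \<Rightarrow> real"
  assumes [measurable]: "f \<in> borel_measurable borel"
  shows "(\<integral>x. f (a + x) \<partial>\<mu>) = (\<integral>x. f x \<partial>\<mu>)"
  by (subst (2) distr_translate[symmetric, of a], subst integral_distr) simp_all

text \<open>\<open>H\<close> is the subgroup generated by \<sigma>-compact sets carrying
  \<open>f\<close> and \<open>g\<close>, and \<open>g'\<close> is a shift measurable representative
  of \<open>g\<close> cut off to \<open>H\<close>. As \<open>H\<close> is a subgroup, the product of
  \<open>f\<close> cut off to \<open>H\<close> with the shifts of \<open>g'\<close> vanishes outside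
  the square of \<open>H\<close>, which reduces joint measurability to
  \<open>shift_measurable_sigma_compact\<close>.\<close>

lemma convolution_reduction:
  fixes f g :: "'g \<Rightarrow> real"
  assumes f: "integrable \<mu> f" and g: "integrable \<mu> g"
  obtains H g' where "sigma_compact H" "integrable \<mu> (\<lambda>x. f x * indicator H x)" "AE x in \<mu>. f x = f x * indicator H x"
    "integrable \<mu> g'" "AE x in \<mu>. g x = g' x"
    "\<forall>x. x \<notin> H \<longrightarrow> g' x = 0" "\<forall>y\<in>H. \<forall>x. - y + x \<in> H \<longleftrightarrow> x \<in> H"
    "(\<lambda>(y, x). f y * indicator H y * g' (- y + x)) \<in> borel_measurable (borel \<Otimes>\<^sub>M borel)"
proof -
  obtain S1 where S1: "sigma_compact S1" "AE x in \<mu>. x \<notin> S1 \<longrightarrow> f x = 0"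
    using integrable_sigma_compact_support[OF f] .
  obtain S2 where S2: "sigma_compact S2" "AE x in \<mu>. x \<notin> S2 \<longrightarrow> g x = 0"
    using integrable_sigma_compact_support[OF g] .
  obtain H where H: "sigma_compact H" "S1 \<union> S2 \<subseteq> H" "0 \<in> H" "\<forall>x\<in>H. \<forall>y\<in>H. x - y \<in> H"
    using sigma_compact_generated_subgroup[OF sigma_compact_Un[OF S1(1) S2(1)]] .
  obtain g0 where g0: "shift_measurable g0" "AE x in \<mu>. g0 x = g x"
    using integrable_AE_eq_shift_measurable[OF g] by blast
  have neg: "- x \<in> H" if "x \<in> H" for x using H(3,4) that by fastforce
  have add: "x + y \<in> H" if "x \<in> H" "y \<in> H" for x y using H(4) neg[OF that(2)] that(1) by fastforce
  have iff: "- y + x \<in> H \<longleftrightarrow> x \<in> H" if "y \<in> H" for x y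
  proof
    assume "- y + x \<in> H"
    from add[OF that this] show "x \<in> H" by (simp add: add.assoc[symmetric])
  qed (use neg add that in blast)
  have [measurable]: "H \<in> sets borel" "f \<in> borel_measurable borel" "g0 \<in> borel_measurable borel"
    using H(1) f g0(1) by (auto intro: borel_measurable_integrable_haar borel_measurable_shift_measurable)
  define g' where "g' x = g0 x * indicator H x" for x
  have aeg: "AE x in \<mu>. g x = g' x"
    using S2(2) g0(2) by eventually_elim (use H(2) in \<open>auto simp: g'_def split: split_indicator\<close>)
  have [measurable]: "g' \<in> borel_measurable borel" unfolding g'_def by measurable
  have "(\<lambda>p. (f (fst p) * indicator H (fst p)) *
      (\<lambda>(y, x). g0 (- y + x) * indicator H y * indicator H x) p) \<in> borel_measurable (borel \<Otimes>\<^sub>M borel)"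
    by (rule borel_measurable_times[OF _ shift_measurable_sigma_compact[OF g0(1) H(1)]]) measurable
  also have "(\<lambda>p. (f (fst p) * indicator H (fst p)) *
      (\<lambda>(y, x). g0 (- y + x) * indicator H y * indicator H x) p) = (\<lambda>(y, x). f y * indicator H y * g' (- y + x))"
    using iff by (auto simp: fun_eq_iff g'_def split: split_indicator)
  finally have joint: "(\<lambda>(y, x). f y * indicator H y * g' (- y + x)) \<in> borel_measurable (borel \<Otimes>\<^sub>M borel)" .
  show thesis
  proof (rule that[OF H(1) _ _ _ aeg _ _ joint])
    show "integrable \<mu> (\<lambda>x. f x * indicator H x)"
      by (rule Bochner_Integration.integrable_bound[OF f]) (auto split: split_indicator)
    show "AE x in \<mu>. f x = f x * indicator H x"
      using S1(2) by eventually_elim (use H(2) in \<open>auto split: split_indicator\<close>)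
    show "integrable \<mu> g'" using integrable_cong_AE_imp[OF g, of g'] aeg by (simp add: eq_commute)
  qed (use iff in \<open>auto simp: g'_def\<close>)
qed

text \<open>
  In the last claim, \<open>c = 0\<close> gives Young's inequality and \<open>c = 1\<close> the estimate for functions
  that are almost invariant under the translations in the support of \<open>f\<close>.
\<close>

lemma
  fixes f g :: "'g \<Rightarrow> real"
  assumes f: "integrable \<mu> f" and g: "integrable \<mu> g"
  shows AE_integrable_convolution: "AE x in \<mu>. integrable \<mu> (\<lambda>y. f y * g (- y + x))" (is ?A)
    and integrable_convolution: "integrable \<mu> (convolution \<mu> f g)" (is ?B)
    and integral_convolution: "(\<integral>x. convolution \<mu> f g x \<partial>\<mu>) = (\<integral>x. f x \<partial>\<mu>) * (\<integral>x. g x \<partial>\<mu>)" (is ?C)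
    and convolution_diff_bound: "(\<And>y. f y \<noteq> 0 \<Longrightarrow> (\<integral>x. \<bar>g (- y + x) - c * g x\<bar> \<partial>\<mu>) \<le> b) \<Longrightarrow> 0 \<le> b \<Longrightarrow>
      (\<integral>x. \<bar>convolution \<mu> f g x - c * (\<integral>y. f y \<partial>\<mu>) * g x\<bar> \<partial>\<mu>) \<le> b * (\<integral>y. \<bar>f y\<bar> \<partial>\<mu>)" (is "PROP ?D")
proof -
  obtain H g' where H: "sigma_compact H" and f': "integrable \<mu> (\<lambda>x. f x * indicator H x)"
    "AE x in \<mu>. f x = f x * indicator H x"
    and g': "integrable \<mu> g'" "AE x in \<mu>. g x = g' x" and g'0': "\<forall>x. x \<notin> H \<longrightarrow> g' x = 0"
    and iff': "\<forall>y\<in>H. \<forall>x. - y + x \<in> H \<longleftrightarrow> x \<in> H"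
    and joint: "(\<lambda>(y, x). f y * indicator H y * g' (- y + x)) \<in> borel_measurable (borel \<Otimes>\<^sub>M borel)"
    using convolution_reduction[OF f g] .
  note g'0 = g'0'[rule_format] and iff = iff'[rule_format]
  define f' where "f' y = f y * indicator H y" for y
  note f' = f'[folded f'_def] and joint = joint[folded f'_def]
  have f'0: "x \<notin> H \<Longrightarrow> f' x = 0" for x by (simp add: f'_def)
  have [measurable]: "H \<in> sets borel" "f \<in> borel_measurable borel" "g \<in> borel_measurable borel"
    "f' \<in> borel_measurable borel" "g' \<in> borel_measurable borel"
    using H f g f' g' by (auto intro: borel_measurable_integrable_haar)
  have cong: "AE y in \<mu>. f y * g (- y + x) = f' y * g' (- y + x)" for x
    by (rule convolution_cong_AE(1)[OF f f'(1,2) _ _ g'(2)]) measurable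
  have conv_eq: "convolution \<mu> f g = convolution \<mu> f' g'"
    by (rule convolution_cong_AE(2)[OF f f'(1,2) _ _ g'(2)]) measurable
  define F where "F = (\<lambda>y x. f' y * g' (- y + x))"
  \<comment> \<open>If \<open>y\<close> is in the subgroup \<open>H\<close> and \<open>x\<close> is
    not, then - y + x is not in \<open>H\<close> either.\<close>
  have F0: "F y x = 0" if "y \<notin> H \<or> x \<notin> H" for y x
    using that iff[of y x] f'0[of y] g'0 by (auto simp: F_def)
  define \<nu> where "\<nu> = density \<mu> (indicator H)"
  have \<nu>': "\<nu> = density \<mu> (\<lambda>x. ennreal (indicator H x))" by (simp add: \<nu>_def ennreal_indicator)
  have s[measurable_cong]: "sets \<nu> = sets \<mu>" by (simp add: \<nu>_def)
  interpret S: sigma_finite_measure \<nu> unfolding \<nu>_def by (rule sigma_finite_density[OF H])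
  interpret pair_sigma_finite \<nu> \<nu> ..
  have Fm: "case_prod F \<in> borel_measurable (borel \<Otimes>\<^sub>M borel)" using joint by (simp add: F_def)
  have [measurable]: "case_prod F \<in> borel_measurable (\<mu> \<Otimes>\<^sub>M \<mu>)"
    using Fm by (simp cong: measurable_cong_sets sets_pair_measure_cong)
  have F'[measurable]: "case_prod F \<in> borel_measurable (\<nu> \<Otimes>\<^sub>M \<nu>)" by measurable
  \<comment> \<open>Functions vanishing outside \<open>H\<close> have the same integral for \<nu>
    and \<mu>, so Fubini's theorem for the \<sigma>-finite \<nu> gives statements about
    \<mu>.\<close>
  have ieq: "(\<integral>x. h x \<partial>\<nu>) = (\<integral>x. h x \<partial>\<mu>)" "integrable \<nu> h \<longleftrightarrow> integrable \<mu> h"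
    if "h \<in> borel_measurable borel" "\<And>x. x \<notin> H \<Longrightarrow> h x = 0" for h :: "'g \<Rightarrow> real"
  proof -
    have "(\<lambda>x. indicator H x *\<^sub>R h x) = h" using that(2) by (auto simp: fun_eq_iff split: split_indicator)
    then show "(\<integral>x. h x \<partial>\<nu>) = (\<integral>x. h x \<partial>\<mu>)" "integrable \<nu> h \<longleftrightarrow> integrable \<mu> h"
      unfolding \<nu>' using that(1) by (simp_all add: integral_density integrable_density)
  qed
  have nn_le: "(\<integral>\<^sup>+x. h x \<partial>\<nu>) \<le> (\<integral>\<^sup>+x. h x \<partial>\<mu>)" if "h \<in> borel_measurable borel" for h :: "'g \<Rightarrow> ennreal"
    unfolding \<nu>_def using that
    by (subst nn_integral_density) (auto intro!: nn_integral_mono split: split_indicator)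
  have Fmy: "(\<lambda>y. F y x) \<in> borel_measurable borel" and Fmx: "(\<lambda>x. F y x) \<in> borel_measurable borel" for x y
    unfolding F_def by measurable
  \<comment> \<open>The double integral of the absolute value of \<open>F\<close> is at most the
    product of the two norms, since left invariance removes the shift by \<open>- y\<close>.\<close>
  have intF: "integrable (\<nu> \<Otimes>\<^sub>M \<nu>) (case_prod F)"
  proof (rule integrableI_bounded[OF F'])
    have "(\<integral>\<^sup>+p. norm (case_prod F p) \<partial>(\<nu> \<Otimes>\<^sub>M \<nu>)) = (\<integral>\<^sup>+y. \<integral>\<^sup>+x. norm (F y x) \<partial>\<nu> \<partial>\<nu>)"
      by (subst S.nn_integral_fst[symmetric]) auto
    also have "\<dots> \<le> (\<integral>\<^sup>+y. ennreal \<bar>f' y\<bar> * (\<integral>\<^sup>+x. \<bar>g' x\<bar> \<partial>\<mu>) \<partial>\<nu>)"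
    proof (intro nn_integral_mono)
      fix y
      have "(\<integral>\<^sup>+x. norm (F y x) \<partial>\<nu>) \<le> (\<integral>\<^sup>+x. norm (F y x) \<partial>\<mu>)"
        by (rule nn_le) (use Fmx in measurable)
      also have "\<dots> = (\<integral>\<^sup>+x. ennreal \<bar>f' y\<bar> * ennreal \<bar>g' (- y + x)\<bar> \<partial>\<mu>)"
        by (simp add: F_def abs_mult ennreal_mult)
      also have "\<dots> = ennreal \<bar>f' y\<bar> * (\<integral>\<^sup>+x. \<bar>g' (- y + x)\<bar> \<partial>\<mu>)"
        by (rule nn_integral_cmult) measurable
      also have "(\<integral>\<^sup>+x. \<bar>g' (- y + x)\<bar> \<partial>\<mu>) = (\<integral>\<^sup>+x. \<bar>g' x\<bar> \<partial>\<mu>)"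
        by (rule nn_integral_translate[of "\<lambda>x. ennreal \<bar>g' x\<bar>"]) measurable
      finally show "(\<integral>\<^sup>+x. norm (F y x) \<partial>\<nu>) \<le> ennreal \<bar>f' y\<bar> * (\<integral>\<^sup>+x. \<bar>g' x\<bar> \<partial>\<mu>)" .
    qed
    also have "\<dots> \<le> (\<integral>\<^sup>+y. ennreal \<bar>f' y\<bar> * (\<integral>\<^sup>+x. \<bar>g' x\<bar> \<partial>\<mu>) \<partial>\<mu>)"
      by (rule nn_le) measurable
    also have "\<dots> = (\<integral>\<^sup>+y. ennreal \<bar>f' y\<bar> \<partial>\<mu>) * (\<integral>\<^sup>+x. \<bar>g' x\<bar> \<partial>\<mu>)"
      by (rule nn_integral_multc) measurable
    also have "\<dots> < \<infinity>"
      using f'(1) g'(1) by (auto simp: integrable_iff_bounded ennreal_mult_less_top)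
    finally show "(\<integral>\<^sup>+p. norm (case_prod F p) \<partial>(\<nu> \<Otimes>\<^sub>M \<nu>)) < \<infinity>" .
  qed
  have convF: "convolution \<mu> f' g' x = (\<integral>y. F y x \<partial>\<mu>)" for x by (simp add: convolution_def F_def)
  have convF\<nu>: "convolution \<mu> f' g' x = (\<integral>y. F y x \<partial>\<nu>)" for x
    unfolding convF by (rule ieq(1)[symmetric, OF Fmy F0]) simp
  have conv0: "convolution \<mu> f' g' x = 0" if "x \<notin> H" for x unfolding convF using that by (simp add: F0)
  have AEint: "AE x in \<mu>. integrable \<mu> (\<lambda>y. F y x)"
  proof -
    have "AE x in \<nu>. integrable \<nu> (\<lambda>y. F y x)" by (rule AE_integrable_snd[OF intF])
    then have "AE x in \<mu>. x \<in> H \<longrightarrow> integrable \<nu> (\<lambda>y. F y x)"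
      unfolding \<nu>_def by (subst (asm) AE_density) (auto simp: indicator_eq_0_iff)
    then show ?thesis
    proof eventually_elim
      case (elim x)
      show ?case
      proof (cases "x \<in> H")
        case True
        with elim show ?thesis using ieq(2)[OF Fmy[of x] F0] by simp
      next
        case False
        then show ?thesis by (simp add: F0)
      qed
    qed
  qed
  show ?A
    using AEint
  proof eventually_elim
    case (elim x)
    show ?case
      by (rule integrable_cong_AE_imp[OF elim]) (use cong[of x] in \<open>auto simp: F_def eq_commute\<close>)
  qed
  have iconv\<nu>: "integrable \<nu> (convolution \<mu> f' g')"
    using integrable_snd[OF intF] unfolding convF\<nu>[symmetric] by (simp add: eta_contract_eq)
  have convm: "convolution \<mu> f' g' \<in> borel_measurable borel"
    using borel_measurable_integrable[OF iconv\<nu>] s sets_haar by (simp cong: measurable_cong_sets)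
  show iconv: ?B
    unfolding conv_eq using ieq(2)[OF convm conv0] iconv\<nu> by simp
  have "(\<integral>x. convolution \<mu> f g x \<partial>\<mu>) = (\<integral>x. convolution \<mu> f' g' x \<partial>\<nu>)"
    unfolding conv_eq by (rule ieq(1)[symmetric, OF convm conv0])
  also have "\<dots> = (\<integral>x. (\<integral>y. F y x \<partial>\<nu>) \<partial>\<nu>)" by (simp add: convF\<nu>)
  also have "\<dots> = (\<integral>y. (\<integral>x. F y x \<partial>\<nu>) \<partial>\<nu>)" by (rule Fubini_integral[OF intF])
  also have "\<dots> = (\<integral>y. f' y * (\<integral>x. g' x \<partial>\<mu>) \<partial>\<nu>)"
  proof (rule Bochner_Integration.integral_cong[OF refl])
    fix y
    have "(\<integral>x. F y x \<partial>\<nu>) = (\<integral>x. F y x \<partial>\<mu>)" by (rule ieq(1)[OF Fmx F0]) simp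
    also have "\<dots> = f' y * (\<integral>x. g' x \<partial>\<mu>)"
      unfolding F_def by (simp add: integral_translate)
    finally show "(\<integral>x. F y x \<partial>\<nu>) = f' y * (\<integral>x. g' x \<partial>\<mu>)" .
  qed
  also have "\<dots> = (\<integral>y. f' y * (\<integral>x. g' x \<partial>\<mu>) \<partial>\<mu>)" by (rule ieq(1)) (auto simp: f'0)
  also have "\<dots> = (\<integral>x. f' x \<partial>\<mu>) * (\<integral>x. g' x \<partial>\<mu>)" by simp
  also have "(\<integral>x. f' x \<partial>\<mu>) = (\<integral>x. f x \<partial>\<mu>)" using f'(2) by (intro integral_cong_AE) (auto simp: eq_commute)
  also have "(\<integral>x. g' x \<partial>\<mu>) = (\<integral>x. g x \<partial>\<mu>)" using g'(2) by (intro integral_cong_AE) (auto simp: eq_commute)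
  finally show ?C .
  assume bnd: "\<And>y. f y \<noteq> 0 \<Longrightarrow> (\<integral>x. \<bar>g (- y + x) - c * g x\<bar> \<partial>\<mu>) \<le> b" and b: "0 \<le> b"
  have If: "(\<integral>y. f y \<partial>\<mu>) = (\<integral>y. f' y \<partial>\<mu>)" using f'(2) by (intro integral_cong_AE) auto
  \<comment> \<open>The subtracted term is itself an integral over \<open>y\<close>, so both terms
    combine into one integral, which is bounded by that of \<open>G\<close>.\<close>
  define G where "G y x = \<bar>F y x - c * f' y * g' x\<bar>" for y x
  have Gm: "(\<lambda>(y, x). ennreal (G y x)) \<in> borel_measurable (borel \<Otimes>\<^sub>M borel)"
    unfolding G_def using Fm by measurable
  have "(\<integral>\<^sup>+x. \<bar>convolution \<mu> f g x - c * (\<integral>y. f y \<partial>\<mu>) * g x\<bar> \<partial>\<mu>)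
    = (\<integral>\<^sup>+x. \<bar>convolution \<mu> f' g' x - c * (\<integral>y. f' y \<partial>\<mu>) * g' x\<bar> \<partial>\<mu>)"
    unfolding conv_eq If using g'(2) by (intro nn_integral_cong_AE) auto
  also have "\<dots> \<le> (\<integral>\<^sup>+x. (\<integral>\<^sup>+y. ennreal (G y x) * indicator H y \<partial>\<mu>) * indicator H x \<partial>\<mu>)"
  proof (rule nn_integral_mono_AE, use AEint in eventually_elim)
    case (elim x)
    have "convolution \<mu> f' g' x - c * (\<integral>y. f' y \<partial>\<mu>) * g' x = (\<integral>y. F y x - c * f' y * g' x \<partial>\<mu>)"
      using elim f'(1) by (simp add: convF)
    also have "ennreal \<bar>\<dots>\<bar> \<le> (\<integral>\<^sup>+y. ennreal (G y x) \<partial>\<mu>)"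
      using integral_norm_bound_ennreal[of \<mu> "\<lambda>y. F y x - c * f' y * g' x"] elim f'(1) by (simp add: G_def)
    also have "(\<integral>\<^sup>+y. ennreal (G y x) \<partial>\<mu>) = (\<integral>\<^sup>+y. ennreal (G y x) * indicator H y \<partial>\<mu>)"
      by (intro nn_integral_cong) (auto simp: G_def F0 f'0 split: split_indicator)
    finally show ?case
      by (cases "x \<in> H") (auto simp: conv0 g'0)
  qed
  \<comment> \<open>With \<open>y\<close> fixed in the inner integral, left translation of
    \<open>g\<close> can be compared with \<open>c * g\<close>: the result is
    \<open>\<bar>f y\<bar>\<close> times a quantity bounded by \<open>b\<close>, or 0 where
    \<open>f' y = 0\<close>.\<close>
  also have "\<dots> = (\<integral>\<^sup>+y. (\<integral>\<^sup>+x. ennreal (G y x) * indicator H x \<partial>\<mu>) * indicator H y \<partial>\<mu>)"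
    by (rule tonelli[OF H Gm])
  also have "\<dots> \<le> (\<integral>\<^sup>+y. ennreal b * ennreal \<bar>f y\<bar> \<partial>\<mu>)"
  proof (rule nn_integral_mono)
    fix y
    show "(\<integral>\<^sup>+x. ennreal (G y x) * indicator H x \<partial>\<mu>) * indicator H y \<le> ennreal b * ennreal \<bar>f y\<bar>"
    proof (cases "f' y = 0")
      case True
      then show ?thesis by (simp add: G_def F_def)
    next
      case False
      then have fy: "f' y = f y" "f y \<noteq> 0" by (auto simp: f'_def indicator_def split: if_splits)
      have ig: "integrable \<mu> (\<lambda>x. g (- y + x) - c * g x)"
        using integrable_translate[OF g] g by simp
      have "(\<integral>\<^sup>+x. ennreal (G y x) * indicator H x \<partial>\<mu>) * indicator H y \<le> (\<integral>\<^sup>+x. G y x \<partial>\<mu>)"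
        by (auto split: split_indicator intro!: nn_integral_mono)
      also have "\<dots> = (\<integral>\<^sup>+x. ennreal \<bar>f y\<bar> * ennreal \<bar>g (- y + x) - c * g x\<bar> \<partial>\<mu>)"
      proof (rule nn_integral_cong_AE)
        show "AE x in \<mu>. ennreal (G y x) = ennreal \<bar>f y\<bar> * ennreal \<bar>g (- y + x) - c * g x\<bar>"
          using g'(2) AE_translate[OF g'(2), of "- y"]
        proof eventually_elim
          case (elim x)
          have "F y x - c * f' y * g' x = f y * (g (- y + x) - c * g x)"
            unfolding F_def fy elim by (simp add: algebra_simps)
          then show ?case by (simp add: G_def abs_mult ennreal_mult)
        qed
      qed
      also have "\<dots> = ennreal \<bar>f y\<bar> * (\<integral>\<^sup>+x. \<bar>g (- y + x) - c * g x\<bar> \<partial>\<mu>)"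
        by (rule nn_integral_cmult) measurable
      also have "(\<integral>\<^sup>+x. \<bar>g (- y + x) - c * g x\<bar> \<partial>\<mu>) = ennreal (\<integral>x. \<bar>g (- y + x) - c * g x\<bar> \<partial>\<mu>)"
        using ig by (intro nn_integral_eq_integral) auto
      also have "ennreal \<bar>f y\<bar> * \<dots> \<le> ennreal \<bar>f y\<bar> * ennreal b"
        using bnd[OF fy(2)] by (intro mult_left_mono ennreal_leI) auto
      finally show ?thesis by (simp add: mult.commute)
    qed
  qed
  also have "\<dots> = ennreal b * (\<integral>\<^sup>+y. ennreal \<bar>f y\<bar> \<partial>\<mu>)" by (rule nn_integral_cmult) measurable
  also have "(\<integral>\<^sup>+y. ennreal \<bar>f y\<bar> \<partial>\<mu>) = ennreal (\<integral>y. \<bar>f y\<bar> \<partial>\<mu>)"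
    using f by (intro nn_integral_eq_integral) auto
  also have "ennreal b * \<dots> = ennreal (b * (\<integral>y. \<bar>f y\<bar> \<partial>\<mu>))" using b by (simp add: ennreal_mult)
  finally have le: "(\<integral>\<^sup>+x. \<bar>convolution \<mu> f g x - c * (\<integral>y. f y \<partial>\<mu>) * g x\<bar> \<partial>\<mu>) \<le> ennreal (b * (\<integral>y. \<bar>f y\<bar> \<partial>\<mu>))" .
  have "(\<integral>\<^sup>+x. \<bar>convolution \<mu> f g x - c * (\<integral>y. f y \<partial>\<mu>) * g x\<bar> \<partial>\<mu>)
    = ennreal (\<integral>x. \<bar>convolution \<mu> f g x - c * (\<integral>y. f y \<partial>\<mu>) * g x\<bar> \<partial>\<mu>)"
    using iconv g by (intro nn_integral_eq_integral) auto
  with le have "ennreal (\<integral>x. \<bar>convolution \<mu> f g x - c * (\<integral>y. f y \<partial>\<mu>) * g x\<bar> \<partial>\<mu>) \<le> ennreal (b * (\<integral>y. \<bar>f y\<bar> \<partial>\<mu>))"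
    by simp
  then show "(\<integral>x. \<bar>convolution \<mu> f g x - c * (\<integral>y. f y \<partial>\<mu>) * g x\<bar> \<partial>\<mu>) \<le> b * (\<integral>y. \<bar>f y\<bar> \<partial>\<mu>)"
    by (subst (asm) ennreal_le_iff) (use b in \<open>auto intro!: mult_nonneg_nonneg integral_nonneg_AE\<close>)
qed

end

section \<open>The metric structure \<open>L\<^sup>1(G)\<close>\<close>

text \<open>The Riesz-Fischer argument: along a subsequence with norms of increments below
  \<open>(1/2)^k\<close>, the increments are absolutely summable almost everywhere, which gives a
  pointwise limit. Fatou's lemma then compares the whole sequence with it.\<close>

lemma L1_complete:
  fixes u :: "nat \<Rightarrow> 'a \<Rightarrow> real"
  assumes u: "\<And>n. integrable M (u n)"
    and cau: "\<And>e. e > 0 \<Longrightarrow> \<exists>N. \<forall>m n. N \<le> m \<longrightarrow> N \<le> n \<longrightarrow> (\<integral>x. \<bar>u m x - u n x\<bar> \<partial>M) < e"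
  obtains v where "integrable M v" "(\<lambda>n. \<integral>x. \<bar>u n x - v x\<bar> \<partial>M) \<longlonglongrightarrow> 0"
proof -
  have [measurable]: "u n \<in> borel_measurable M" for n using u by simp
  have nn: "(\<integral>\<^sup>+x. ennreal \<bar>u m x - u n x\<bar> \<partial>M) = ennreal (\<integral>x. \<bar>u m x - u n x\<bar> \<partial>M)" for m n
    using u by (intro nn_integral_eq_integral) auto
  have "\<exists>r::nat \<Rightarrow> nat. \<forall>k. (\<forall>m n. r k \<le> m \<longrightarrow> r k \<le> n \<longrightarrow> (\<integral>x. \<bar>u m x - u n x\<bar> \<partial>M) < (1/2)^k) \<and> r k < r (Suc k)"
  proof (rule dependent_nat_choice)
    show "\<exists>N. \<forall>m n. N \<le> m \<longrightarrow> N \<le> n \<longrightarrow> (\<integral>x. \<bar>u m x - u n x\<bar> \<partial>M) < (1/2)^0" using cau[of 1] by simp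
    fix N k :: nat
    obtain N' where N': "\<forall>m n. N' \<le> m \<longrightarrow> N' \<le> n \<longrightarrow> (\<integral>x. \<bar>u m x - u n x\<bar> \<partial>M) < (1/2)^Suc k"
      using cau[of "(1/2)^Suc k"] by auto
    \<comment> \<open>The maximum with \<open>Suc N\<close> makes the chosen indices strictly
      increasing.\<close>
    show "\<exists>y. (\<forall>m n. y \<le> m \<longrightarrow> y \<le> n \<longrightarrow> (\<integral>x. \<bar>u m x - u n x\<bar> \<partial>M) < (1/2)^Suc k) \<and> N < y"
      using N' by (intro exI[of _ "max N' (Suc N)"]) auto
  qed
  then obtain r :: "nat \<Rightarrow> nat" where r: "\<And>k m n. r k \<le> m \<Longrightarrow> r k \<le> n \<Longrightarrow> (\<integral>x. \<bar>u m x - u n x\<bar> \<partial>M) < (1/2)^k"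
    "\<And>k. r k < r (Suc k)" by blast
  have sm: "strict_mono r" using r(2) by (simp add: strict_mono_Suc_iff)
  have "(\<integral>\<^sup>+x. (\<Sum>k. ennreal \<bar>u (r (Suc k)) x - u (r k) x\<bar>) \<partial>M) = (\<Sum>k. \<integral>\<^sup>+x. ennreal \<bar>u (r (Suc k)) x - u (r k) x\<bar> \<partial>M)"
    by (rule nn_integral_suminf) measurable
  also have "\<dots> \<le> (\<Sum>k. ennreal ((1/2)^k))"
    unfolding nn using r by (intro suminf_le) (auto intro!: ennreal_leI less_imp_le[of "integral\<^sup>L _ _"] less_imp_le[of "r _"])
  also have "\<dots> = ennreal (\<Sum>k. (1/2)^k)"
    by (rule suminf_ennreal2) (auto intro: summable_geometric)
  finally have "(\<integral>\<^sup>+x. (\<Sum>k. ennreal \<bar>u (r (Suc k)) x - u (r k) x\<bar>) \<partial>M) \<noteq> \<infinity>"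
    by (auto simp: top_unique)
  then have "AE x in M. (\<Sum>k. ennreal \<bar>u (r (Suc k)) x - u (r k) x\<bar>) \<noteq> \<infinity>"
    by (intro nn_integral_PInf_AE) auto
  then have conv: "AE x in M. (\<lambda>k. u (r k) x) \<longlonglongrightarrow> lim (\<lambda>k. u (r k) x)"
  proof eventually_elim
    case (elim x)
    then have "summable (\<lambda>k. \<bar>u (r (Suc k)) x - u (r k) x\<bar>)"
      by (intro summable_suminf_not_top) auto
    then have "summable (\<lambda>k. u (r (Suc k)) x - u (r k) x)" by (rule summable_rabs_cancel)
    then have "convergent (\<lambda>n. \<Sum>k<n. u (r (Suc k)) x - u (r k) x)" by (simp add: summable_iff_convergent)
    then have "convergent (\<lambda>n. u (r n) x - u (r 0) x)"
      by (simp add: sum_lessThan_telescope[of "\<lambda>k. u (r k) x"])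
    from convergent_add[OF this convergent_const[of "u (r 0) x"]]
    show ?case by (simp add: convergent_LIMSEQ_iff)
  qed
  define v where "v x = lim (\<lambda>k. u (r k) x)" for x
  have [measurable]: "v \<in> borel_measurable M" unfolding v_def by measurable
  have fatou: "(\<integral>\<^sup>+x. ennreal \<bar>u m x - v x\<bar> \<partial>M) \<le> ennreal e"
    if N: "\<And>n. N \<le> n \<Longrightarrow> (\<integral>x. \<bar>u m x - u n x\<bar> \<partial>M) < e" for N m e
  proof -
    have "(\<integral>\<^sup>+x. ennreal \<bar>u m x - v x\<bar> \<partial>M) = (\<integral>\<^sup>+x. liminf (\<lambda>k. ennreal \<bar>u m x - u (r k) x\<bar>) \<partial>M)"
    proof (rule nn_integral_cong_AE, use conv in eventually_elim)
      case (elim x)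
      have "(\<lambda>k. ennreal \<bar>u m x - u (r k) x\<bar>) \<longlonglongrightarrow> ennreal \<bar>u m x - v x\<bar>"
        using elim unfolding v_def by (intro tendsto_intros)
      from lim_imp_Liminf[OF _ this] show ?case by simp
    qed
    also have "\<dots> \<le> liminf (\<lambda>k. \<integral>\<^sup>+x. ennreal \<bar>u m x - u (r k) x\<bar> \<partial>M)"
      by (rule nn_integral_liminf) measurable
    also have "\<dots> \<le> limsup (\<lambda>k. \<integral>\<^sup>+x. ennreal \<bar>u m x - u (r k) x\<bar> \<partial>M)"
      by (rule Liminf_le_Limsup) simp
    also have "\<dots> \<le> ennreal e"
    proof (rule Limsup_bounded)
      have "N \<le> r k" if "N \<le> k" for k using that seq_suble[OF sm, of k] by simp
      then show "\<forall>\<^sub>F k in sequentially. (\<integral>\<^sup>+x. ennreal \<bar>u m x - u (r k) x\<bar> \<partial>M) \<le> ennreal e"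
        unfolding nn using N by (intro eventually_sequentiallyI[of N] ennreal_leI less_imp_le) auto
    qed
    finally show ?thesis .
  qed
  have d: "integrable M (\<lambda>x. u m x - v x)" if "r 0 \<le> m" for m
    using fatou[of "r 0" m 1] r(1)[of 0 m] that
    by (intro integrableI_bounded) (auto intro: le_less_trans)
  have "integrable M v"
    using Bochner_Integration.integrable_diff[OF u[of "r 0"] d[OF order.refl]] by simp
  moreover have "(\<lambda>n. \<integral>x. \<bar>u n x - v x\<bar> \<partial>M) \<longlonglongrightarrow> 0"
  proof (rule LIMSEQ_I)
    fix e :: real assume e: "0 < e"
    obtain N where N: "\<forall>m n. N \<le> m \<longrightarrow> N \<le> n \<longrightarrow> (\<integral>x. \<bar>u m x - u n x\<bar> \<partial>M) < e / 2"
      using cau[of "e / 2"] e by auto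
    have "norm ((\<integral>x. \<bar>u n x - v x\<bar> \<partial>M) - 0) < e" if n: "N \<le> n" for n
    proof -
      have "ennreal (\<integral>x. \<bar>u n x - v x\<bar> \<partial>M) = (\<integral>\<^sup>+x. ennreal \<bar>u n x - v x\<bar> \<partial>M)"
        using u \<open>integrable M v\<close> by (intro nn_integral_eq_integral[symmetric]) auto
      also have "\<dots> \<le> ennreal (e / 2)" using N n by (intro fatou[of N]) auto
      finally have "(\<integral>x. \<bar>u n x - v x\<bar> \<partial>M) \<le> e / 2" using e by (subst (asm) ennreal_le_iff) auto
      then show ?thesis using e by (simp add: integral_nonneg_AE)
    qed
    then show "\<exists>N. \<forall>n\<ge>N. norm ((\<integral>x. \<bar>u n x - v x\<bar> \<partial>M) - 0) < e" by blast
  qed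
  ultimately show thesis by (rule that)
qed

section \<open>Classes of integrable functions and the unit ball\<close>

lemma L1_class_cong:
  assumes "AE x in M. f x = g x"
  shows "L1_class M f = L1_class M g"
proof -
  have "(AE x in M. h x = f x) \<longleftrightarrow> (AE x in M. h x = g x)" for h
    using assms by (auto elim: eventually_elim2)
  then show ?thesis by (simp add: L1_class_def)
qed

lemma rep_L1_class:
  assumes "integrable M f"
  shows "integrable M (rep (L1_class M f))" "AE x in M. rep (L1_class M f) x = f x"
proof -
  have "f \<in> L1_class M f" using assms by (simp add: L1_class_def)
  then have "rep (L1_class M f) \<in> L1_class M f" unfolding rep_def by (rule someI[of "\<lambda>h. h \<in> L1_class M f"])
  then show "integrable M (rep (L1_class M f))" "AE x in M. rep (L1_class M f) x = f x"
    by (auto simp: L1_class_def)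
qed

lemma L1_norm_cong:
  assumes "AE x in M. f x = g x" "f \<in> borel_measurable M" "g \<in> borel_measurable M"
  shows "L1_norm M f = L1_norm M g"
  unfolding L1_norm_def using assms by (intro integral_cong_AE) auto

lemma L1_norm_rep:
  assumes "integrable M f"
  shows "L1_norm M (rep (L1_class M f)) = L1_norm M f"
  using rep_L1_class[OF assms] assms by (intro L1_norm_cong) auto

lemma L1_dist_rep:
  assumes "integrable M f" "integrable M g"
  shows "L1_norm M (\<lambda>x. rep (L1_class M f) x - rep (L1_class M g) x) = L1_norm M (\<lambda>x. f x - g x)"
proof (rule L1_norm_cong)
  show "AE x in M. rep (L1_class M f) x - rep (L1_class M g) x = f x - g x"
    using rep_L1_class(2)[OF assms(1)] rep_L1_class(2)[OF assms(2)] by eventually_elim simp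
qed (use rep_L1_class(1)[OF assms(1)] rep_L1_class(1)[OF assms(2)] assms in auto)

lemma L1_ball_rep:
  assumes "A \<in> L1_ball M"
  shows "integrable M (rep A)" "L1_norm M (rep A) \<le> 1" "L1_class M (rep A) = A"
proof -
  obtain f where f: "A = L1_class M f" "integrable M f" "L1_norm M f \<le> 1"
    using assms by (auto simp: L1_ball_def)
  show "integrable M (rep A)" "L1_norm M (rep A) \<le> 1"
    using f rep_L1_class(1)[OF f(2)] L1_norm_rep[OF f(2)] by auto
  show "L1_class M (rep A) = A"
    unfolding f(1) using rep_L1_class(2)[OF f(2)] by (rule L1_class_cong)
qed

lemma L1_ballI: "integrable M f \<Longrightarrow> L1_norm M f \<le> 1 \<Longrightarrow> L1_class M f \<in> L1_ball M"
  unfolding L1_ball_def by blast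

lemma L1_norm_nonneg [simp]: "0 \<le> L1_norm M f"
  unfolding L1_norm_def by (rule integral_nonneg_AE) simp

text \<open>The factor \<open>c\<close> is 1 in triangle inequalities and 1/2 for the rescaled
  operations and for halved differences.\<close>

lemma L1_norm_le_add:
  assumes "integrable M f" "integrable M g" "h \<in> borel_measurable M" "AE x in M. \<bar>h x\<bar> \<le> c * (\<bar>f x\<bar> + \<bar>g x\<bar>)"
  shows "L1_norm M h \<le> c * (L1_norm M f + L1_norm M g)" "integrable M h"
proof -
  have i: "integrable M (\<lambda>x. c * (\<bar>f x\<bar> + \<bar>g x\<bar>))" using assms by auto
  show h: "integrable M h"
    by (rule Bochner_Integration.integrable_bound[OF i assms(3)]) (use assms(4) in auto)
  have "L1_norm M h \<le> (\<integral>x. c * (\<bar>f x\<bar> + \<bar>g x\<bar>) \<partial>M)"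
    unfolding L1_norm_def using h i assms(4) by (intro integral_mono_AE) auto
  also have "\<dots> = c * (L1_norm M f + L1_norm M g)" using assms by (simp add: L1_norm_def)
  finally show "L1_norm M h \<le> c * (L1_norm M f + L1_norm M g)" .
qed

lemma L1_triangle:
  assumes "integrable M f" "integrable M g" "integrable M h"
  shows "L1_norm M (\<lambda>x. f x - h x) \<le> L1_norm M (\<lambda>x. f x - g x) + L1_norm M (\<lambda>x. g x - h x)"
  using L1_norm_le_add(1)[of M "\<lambda>x. f x - g x" "\<lambda>x. g x - h x" "\<lambda>x. f x - h x" 1] assms by auto

lemma Metric_space_L1_ball: "Metric_space (L1_ball M) (\<lambda>A B. L1_norm M (\<lambda>x. rep A x - rep B x))"
proof
  fix A B C
  show "L1_norm M (\<lambda>x. rep A x - rep B x) = L1_norm M (\<lambda>x. rep B x - rep A x)"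
    by (simp add: L1_norm_def abs_minus_commute)
  show "L1_norm M (\<lambda>x. rep A x - rep B x) = 0 \<longleftrightarrow> A = B" if "A \<in> L1_ball M" "B \<in> L1_ball M"
  proof
    note A = L1_ball_rep[OF that(1)] and B = L1_ball_rep[OF that(2)]
    assume "L1_norm M (\<lambda>x. rep A x - rep B x) = 0"
    then have "AE x in M. \<bar>rep A x - rep B x\<bar> = 0"
      unfolding L1_norm_def using A B by (subst (asm) integral_nonneg_eq_0_iff_AE) auto
    then have "AE x in M. rep A x = rep B x" by eventually_elim simp
    from L1_class_cong[OF this] show "A = B" using A B by simp
  qed (simp add: L1_norm_def)
  show "L1_norm M (\<lambda>x. rep A x - rep C x) \<le> L1_norm M (\<lambda>x. rep A x - rep B x) + L1_norm M (\<lambda>x. rep B x - rep C x)"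
    if "A \<in> L1_ball M" "B \<in> L1_ball M" "C \<in> L1_ball M"
    using that by (intro L1_triangle L1_ball_rep)
qed simp

lemma mcomplete_L1_ball: "Metric_space.mcomplete (L1_ball M) (\<lambda>A B. L1_norm M (\<lambda>x. rep A x - rep B x))"
proof -
  interpret Metric_space "L1_ball M" "\<lambda>A B. L1_norm M (\<lambda>x. rep A x - rep B x)"
    by (rule Metric_space_L1_ball)
  show ?thesis
    unfolding mcomplete_def
  proof (intro allI impI)
    fix \<sigma> assume cau: "MCauchy \<sigma>"
    have \<sigma>: "\<sigma> n \<in> L1_ball M" for n using cau by (auto simp: MCauchy_def)
    note ball = L1_ball_rep[OF \<sigma>]
    obtain v where v: "integrable M v" "(\<lambda>n. \<integral>x. \<bar>rep (\<sigma> n) x - v x\<bar> \<partial>M) \<longlonglongrightarrow> 0"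
    proof (rule L1_complete[of M "\<lambda>n. rep (\<sigma> n)"])
      show "\<exists>N. \<forall>m n. N \<le> m \<longrightarrow> N \<le> n \<longrightarrow> (\<integral>x. \<bar>rep (\<sigma> m) x - rep (\<sigma> n) x\<bar> \<partial>M) < e" if "0 < e" for e
        using cau[unfolded MCauchy_def] that unfolding L1_norm_def by blast
    qed (use ball in auto)
    \<comment> \<open>Letting \<open>n\<close> tend to infinity in this bound places the limit in
      the unit ball.\<close>
    have "L1_norm M v \<le> 1 + (\<integral>x. \<bar>rep (\<sigma> n) x - v x\<bar> \<partial>M)" for n
    proof -
      have "L1_norm M v \<le> 1 * (L1_norm M (rep (\<sigma> n)) + L1_norm M (\<lambda>x. rep (\<sigma> n) x - v x))"
        using v ball by (intro L1_norm_le_add(1)) auto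
      then show ?thesis using ball(2)[of n] by (simp add: L1_norm_def)
    qed
    then have "L1_norm M v \<le> 1 + 0"
      using tendsto_add[OF tendsto_const v(2), of 1] by (intro LIMSEQ_le_const) auto
    then have vb: "L1_class M v \<in> L1_ball M" using v by (intro L1_ballI) auto
    have "(\<lambda>n. L1_norm M (\<lambda>x. rep (\<sigma> n) x - rep (L1_class M v) x)) \<longlonglongrightarrow> 0"
      using v(2) L1_dist_rep[OF ball(1) v(1)] unfolding ball(3) by (simp add: L1_norm_def)
    then show "\<exists>x. limitin mtopology \<sigma> x sequentially"
      using vb \<sigma> by (intro exI[of _ "L1_class M v"]) (simp add: limitin_metric_dist_null)
  qed
qed

section \<open>The operations of the language and their moduli of continuity\<close>

context haar
begin

lemma L1_norm_convolution:
  assumes "integrable \<mu> f" "integrable \<mu> g"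
  shows "L1_norm \<mu> (convolution \<mu> f g) \<le> L1_norm \<mu> f * L1_norm \<mu> g"
proof -
  have [measurable]: "g \<in> borel_measurable borel" using assms by (intro borel_measurable_integrable_haar)
  have "(\<integral>x. \<bar>g (- y + x)\<bar> \<partial>\<mu>) = (\<integral>x. \<bar>g x\<bar> \<partial>\<mu>)" for y
    by (rule integral_translate[of "\<lambda>x. \<bar>g x\<bar>"]) measurable
  then show ?thesis
    using convolution_diff_bound[OF assms, of 0 "L1_norm \<mu> g"] by (simp add: L1_norm_def mult.commute)
qed

text \<open>Bilinearity gives f * g - f' * g' = f * (g - g') + (f - f') * g', at least at almost
  every point, where the integrals involved converge.\<close>

lemma L1_norm_convolution_diff:
  assumes f: "integrable \<mu> f" "integrable \<mu> f'" and g: "integrable \<mu> g" "integrable \<mu> g'"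
  shows "L1_norm \<mu> (\<lambda>x. convolution \<mu> f g x - convolution \<mu> f' g' x)
    \<le> L1_norm \<mu> f * L1_norm \<mu> (\<lambda>x. g x - g' x) + L1_norm \<mu> (\<lambda>x. f x - f' x) * L1_norm \<mu> g'"
proof -
  let ?a = "convolution \<mu> f (\<lambda>x. g x - g' x)" and ?b = "convolution \<mu> (\<lambda>x. f x - f' x) g'"
  have i: "integrable \<mu> (\<lambda>x. g x - g' x)" "integrable \<mu> (\<lambda>x. f x - f' x)" using f g by auto
  have "AE x in \<mu>. convolution \<mu> f g x - convolution \<mu> f' g' x = ?a x + ?b x"
    using AE_integrable_convolution[OF f(1) g(1)] AE_integrable_convolution[OF f(1) g(2)] AE_integrable_convolution[OF f(2) g(2)]
    by eventually_elim (simp add: convolution_def right_diff_distrib left_diff_distrib)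
  then have "AE x in \<mu>. \<bar>convolution \<mu> f g x - convolution \<mu> f' g' x\<bar> \<le> 1 * (\<bar>?a x\<bar> + \<bar>?b x\<bar>)"
    by eventually_elim simp
  then have "L1_norm \<mu> (\<lambda>x. convolution \<mu> f g x - convolution \<mu> f' g' x) \<le> 1 * (L1_norm \<mu> ?a + L1_norm \<mu> ?b)"
    using integrable_convolution[OF f(1) g(1)] integrable_convolution[OF f(2) g(2)]
      integrable_convolution[OF f(1) i(1)] integrable_convolution[OF i(2) g(2)]
    by (intro L1_norm_le_add(1)) auto
  then show ?thesis
    using L1_norm_convolution[OF f(1) i(1)] L1_norm_convolution[OF i(2) g(2)] by simp
qed

text \<open>The interpretation of the symbols on functions, before passing to classes; norm
  estimates are made at this level.\<close>

definition sym_op :: "cnv_fun \<Rightarrow> ('g \<Rightarrow> real) \<Rightarrow> ('g \<Rightarrow> real) \<Rightarrow> 'g \<Rightarrow> real" where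
  "sym_op s f g = (case s of
        PlusS \<Rightarrow> (\<lambda>x. (f x + g x) / 2)
      | ZeroS \<Rightarrow> (\<lambda>x. 0)
      | MeetS \<Rightarrow> (\<lambda>x. min (f x) (g x) / 2)
      | JoinS \<Rightarrow> (\<lambda>x. max (f x) (g x) / 2)
      | ConvS \<Rightarrow> convolution \<mu> f g)"

lemma L1_fint_sym_op: "L1_fint \<mu> s As = L1_class \<mu> (sym_op s (rep (As ! 0)) (rep (As ! 1)))"
  by (cases s) (simp_all add: L1_fint_def sym_op_def)

lemma sym_op_integrable:
  assumes f: "integrable \<mu> f" and g: "integrable \<mu> g"
  shows "integrable \<mu> (sym_op s f g)"
  using assms by (cases s) (auto simp: sym_op_def intro: integrable_convolution)

lemma sym_op_norm:
  assumes f: "integrable \<mu> f" "L1_norm \<mu> f \<le> 1" and g: "integrable \<mu> g" "L1_norm \<mu> g \<le> 1"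
  shows "L1_norm \<mu> (sym_op s f g) \<le> 1"
proof (cases "s = ConvS")
  case True
  have "L1_norm \<mu> f * L1_norm \<mu> g \<le> 1" using f g by (intro mult_le_one) auto
  then show ?thesis using L1_norm_convolution[OF f(1) g(1)] True by (simp add: sym_op_def)
next
  case False
  have "L1_norm \<mu> (sym_op s f g) \<le> 1/2 * (L1_norm \<mu> f + L1_norm \<mu> g)"
  proof (rule L1_norm_le_add(1)[OF f(1) g(1)])
    show "sym_op s f g \<in> borel_measurable \<mu>" using sym_op_integrable[OF f(1) g(1)] by simp
    show "AE x in \<mu>. \<bar>sym_op s f g x\<bar> \<le> 1/2 * (\<bar>f x\<bar> + \<bar>g x\<bar>)"
      using False by (cases s) (auto simp: sym_op_def)
  qed
  then show ?thesis using f g by simp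
qed

text \<open>Half sums, minima and maxima differ pointwise by at most half the sum of the differences
  of the arguments, so the modulus \<epsilon> suffices. For convolution both arguments contribute
  their full distance, hence \<epsilon>/2.\<close>

lemma sym_op_diff:
  assumes f: "integrable \<mu> f" "L1_norm \<mu> f \<le> 1" "integrable \<mu> f'"
    and g: "integrable \<mu> g" "integrable \<mu> g'" "L1_norm \<mu> g' \<le> 1"
    and e: "L1_norm \<mu> (\<lambda>x. f x - f' x) < fmod L_cnv s \<epsilon>" "L1_norm \<mu> (\<lambda>x. g x - g' x) < fmod L_cnv s \<epsilon>"
  shows "L1_norm \<mu> (\<lambda>x. sym_op s f g x - sym_op s f' g' x) \<le> \<epsilon>"
proof (cases "s = ConvS")
  case True
  have "L1_norm \<mu> f * L1_norm \<mu> (\<lambda>x. g x - g' x) \<le> 1 * L1_norm \<mu> (\<lambda>x. g x - g' x)"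
    "L1_norm \<mu> (\<lambda>x. f x - f' x) * L1_norm \<mu> g' \<le> L1_norm \<mu> (\<lambda>x. f x - f' x) * 1"
    using f g by (intro mult_right_mono mult_left_mono; simp)+
  then show ?thesis
    using L1_norm_convolution_diff[OF f(1,3) g(1,2)] e True by (simp add: sym_op_def L_cnv_def)
next
  case False
  have "L1_norm \<mu> (\<lambda>x. sym_op s f g x - sym_op s f' g' x) \<le> 1/2 * (L1_norm \<mu> (\<lambda>x. f x - f' x) + L1_norm \<mu> (\<lambda>x. g x - g' x))"
  proof (rule L1_norm_le_add(1))
    show "(\<lambda>x. sym_op s f g x - sym_op s f' g' x) \<in> borel_measurable \<mu>"
      using sym_op_integrable[OF f(1) g(1), of s] sym_op_integrable[OF f(3) g(2), of s] by auto
    show "AE x in \<mu>. \<bar>sym_op s f g x - sym_op s f' g' x\<bar> \<le> 1/2 * (\<bar>f x - f' x\<bar> + \<bar>g x - g' x\<bar>)"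
      using False by (cases s) (auto simp: sym_op_def min_def max_def abs_if field_simps)
  qed (use f g in auto)
  then show ?thesis using e False by (cases s) (simp_all add: L_cnv_def)
qed

lemma metric_structure_L1_conv: "metric_structure L_cnv (L1_conv \<mu>)"
  unfolding metric_structure_def
proof (intro conjI ballI allI impI)
  have z: "L1_class \<mu> (\<lambda>x. 0) \<in> L1_ball \<mu>" by (rule L1_ballI) (auto simp: L1_norm_def)
  then show "univ (L1_conv \<mu>) \<noteq> {}" by (auto simp: L1_conv_def)
  show "Metric_space (univ (L1_conv \<mu>)) (cdist (L1_conv \<mu>))"
    by (simp add: L1_conv_def Metric_space_L1_ball)
  show "Metric_space.mcomplete (univ (L1_conv \<mu>)) (cdist (L1_conv \<mu>))"
    by (simp add: L1_conv_def mcomplete_L1_ball)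
  show "cdist (L1_conv \<mu>) A B \<le> diam L_cnv" if "A \<in> univ (L1_conv \<mu>)" "B \<in> univ (L1_conv \<mu>)" for A B
  proof -
    have A: "A \<in> L1_ball \<mu>" and B: "B \<in> L1_ball \<mu>" using that by (auto simp: L1_conv_def)
    have "L1_norm \<mu> (\<lambda>x. rep A x - rep B x) \<le> 1 * (L1_norm \<mu> (rep A) + L1_norm \<mu> (rep B))"
      using L1_ball_rep[OF A] L1_ball_rep[OF B] by (intro L1_norm_le_add(1)) auto
    then show ?thesis using L1_ball_rep(2)[OF A] L1_ball_rep(2)[OF B] by (simp add: L1_conv_def L_cnv_def)
  qed
  \<comment> \<open>\<open>ZeroS\<close> has arity 0, so \<open>xs ! 0\<close> and
    \<open>xs ! 1\<close> are unspecified there; this symbol is treated apart throughout.\<close>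
  have args: "(s = ZeroS \<or> (xs ! 0 \<in> L1_ball \<mu> \<and> xs ! 1 \<in> L1_ball \<mu>))"
    if "xs \<in> tuples (univ (L1_conv \<mu>)) (farity L_cnv s)" for s xs
  proof -
    have "set xs \<subseteq> L1_ball \<mu>" "length xs = farity L_cnv s" using that by (auto simp: tuples_def L1_conv_def)
    moreover have "s \<noteq> ZeroS \<Longrightarrow> farity L_cnv s = 2" by (cases s) (auto simp: L_cnv_def)
    ultimately show ?thesis by (auto simp: subset_iff)
  qed
  have zero: "sym_op ZeroS f g = (\<lambda>_. 0)" for f g by (simp add: sym_op_def)
  have int: "integrable \<mu> (sym_op s (rep (xs ! 0)) (rep (xs ! 1)))" 
    if "xs \<in> tuples (univ (L1_conv \<mu>)) (farity L_cnv s)" for s xs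
    using args[OF that] by (cases "s = ZeroS") (auto simp: zero intro!: sym_op_integrable L1_ball_rep)
  show "fint (L1_conv \<mu>) s xs \<in> univ (L1_conv \<mu>)" if "xs \<in> tuples (univ (L1_conv \<mu>)) (farity L_cnv s)" for s xs
  proof -
    have "L1_norm \<mu> (sym_op s (rep (xs ! 0)) (rep (xs ! 1))) \<le> 1"
    proof (cases "s = ZeroS")
      case True
      then show ?thesis by (simp add: zero L1_norm_def)
    next
      case False
      then show ?thesis using args[OF that] by (intro sym_op_norm L1_ball_rep) auto
    qed
    then show ?thesis using int[OF that] by (simp add: L1_conv_def L1_fint_sym_op L1_ballI)
  qed
  show "cdist (L1_conv \<mu>) (fint (L1_conv \<mu>) s xs) (fint (L1_conv \<mu>) s ys) \<le> \<epsilon>"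
    if xs: "xs \<in> tuples (univ (L1_conv \<mu>)) (farity L_cnv s)" and ys: "ys \<in> tuples (univ (L1_conv \<mu>)) (farity L_cnv s)"
      and \<epsilon>: "0 < \<epsilon>" and d: "\<forall>i<farity L_cnv s. cdist (L1_conv \<mu>) (xs ! i) (ys ! i) < fmod L_cnv s \<epsilon>"
    for s xs ys \<epsilon>
  proof -
    have "cdist (L1_conv \<mu>) (fint (L1_conv \<mu>) s xs) (fint (L1_conv \<mu>) s ys) =
      L1_norm \<mu> (\<lambda>x. sym_op s (rep (xs ! 0)) (rep (xs ! 1)) x - sym_op s (rep (ys ! 0)) (rep (ys ! 1)) x)"
      unfolding L1_conv_def cstruct.simps L1_fint_sym_op by (rule L1_dist_rep[OF int[OF xs] int[OF ys]])
    also have "\<dots> \<le> \<epsilon>"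
    proof (cases "s = ZeroS")
      case True
      then show ?thesis using \<epsilon> by (simp add: zero L1_norm_def)
    next
      case False
      then have "farity L_cnv s = 2" by (cases s) (auto simp: L_cnv_def)
      then have "L1_norm \<mu> (\<lambda>x. rep (xs ! 0) x - rep (ys ! 0) x) < fmod L_cnv s \<epsilon>"
        "L1_norm \<mu> (\<lambda>x. rep (xs ! 1) x - rep (ys ! 1) x) < fmod L_cnv s \<epsilon>"
        using d by (auto simp: L1_conv_def)
      then show ?thesis using args[OF xs] args[OF ys] False by (intro sym_op_diff L1_ball_rep) auto
    qed
    finally show ?thesis .
  qed
  have arg: "xs ! 0 \<in> L1_ball \<mu>" if "xs \<in> tuples (univ (L1_conv \<mu>)) (parity L_cnv p)" for p xs
    using that by (auto simp: tuples_def L1_conv_def L_cnv_def length_Suc_conv)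
  show "pint (L1_conv \<mu>) p xs \<in> prange L_cnv p" if "xs \<in> tuples (univ (L1_conv \<mu>)) (parity L_cnv p)" for p xs
    using L1_ball_rep(2)[OF arg[OF that]] by (simp add: L1_conv_def L_cnv_def)
  show "\<bar>pint (L1_conv \<mu>) p xs - pint (L1_conv \<mu>) p ys\<bar> \<le> \<epsilon>"
    if xs: "xs \<in> tuples (univ (L1_conv \<mu>)) (parity L_cnv p)" and ys: "ys \<in> tuples (univ (L1_conv \<mu>)) (parity L_cnv p)"
      and \<epsilon>: "0 < \<epsilon>" and d: "\<forall>i<parity L_cnv p. cdist (L1_conv \<mu>) (xs ! i) (ys ! i) < pmod L_cnv p \<epsilon>"
    for p xs ys \<epsilon>
  proof -
    have i: "integrable \<mu> (rep (xs ! 0))" "integrable \<mu> (rep (ys ! 0))"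
      using L1_ball_rep(1) arg[OF xs] arg[OF ys] by auto
    have "L1_norm \<mu> (\<lambda>x. rep (xs ! 0) x - rep (ys ! 0) x) < \<epsilon>"
      using d by (simp add: L1_conv_def L_cnv_def)
    moreover have "L1_norm \<mu> (rep (xs ! 0)) \<le> 1 * (L1_norm \<mu> (rep (ys ! 0)) + L1_norm \<mu> (\<lambda>x. rep (xs ! 0) x - rep (ys ! 0) x))"
      "L1_norm \<mu> (rep (ys ! 0)) \<le> 1 * (L1_norm \<mu> (rep (xs ! 0)) + L1_norm \<mu> (\<lambda>x. rep (xs ! 0) x - rep (ys ! 0) x))"
      using i by (intro L1_norm_le_add(1); auto)+
    ultimately show ?thesis by (simp add: L1_conv_def abs_le_iff)
  qed
qed

section \<open>The order property\<close>

definition uniform_on :: "'g set \<Rightarrow> 'g \<Rightarrow> real" where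
  "uniform_on A x = indicator A x / measure \<mu> A"

lemma uniform_on_props:
  assumes "compact A" "0 < measure \<mu> A"
  shows "integrable \<mu> (uniform_on A)" "(\<integral>x. uniform_on A x \<partial>\<mu>) = 1" "0 \<le> uniform_on A x" "L1_norm \<mu> (uniform_on A) = 1"
proof -
  have A: "A \<in> sets \<mu>" using borel_compact_group[OF assms(1)] by simp
  show i: "integrable \<mu> (uniform_on A)" unfolding uniform_on_def using A finite_on_compact[OF assms(1)] by simp
  show e: "(\<integral>x. uniform_on A x \<partial>\<mu>) = 1" unfolding uniform_on_def using A assms by simp
  show p: "0 \<le> uniform_on A x" for x unfolding uniform_on_def using assms by simp
  show "L1_norm \<mu> (uniform_on A) = 1" using e p unfolding L1_norm_def by simp
qed

text \<open>The convolution averages the left translates of \<open>uniform_on E\<close> by elements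
  of \<open>K\<close>, each of which is \<epsilon>-close to \<open>uniform_on E\<close>. This is the
  case \<open>c = 1\<close> of \<open>convolution_diff_bound\<close>.\<close>

lemma convolution_uniform_on_near:
  assumes K: "compact K" "0 < measure \<mu> K" and E: "compact E" "0 < measure \<mu> E" and \<epsilon>: "0 < \<epsilon>"
    and inv: "\<And>y. y \<in> K \<Longrightarrow> measure \<mu> (sym_diff ((\<lambda>x. y + x) ` E) E) / measure \<mu> E < \<epsilon>"
  shows "L1_norm \<mu> (\<lambda>x. convolution \<mu> (uniform_on K) (uniform_on E) x - uniform_on E x) \<le> \<epsilon>"
proof -
  note aK = uniform_on_props[OF K] and aE = uniform_on_props[OF E]
  have "(\<integral>x. \<bar>convolution \<mu> (uniform_on K) (uniform_on E) x - 1 * (\<integral>y. uniform_on K y \<partial>\<mu>) * uniform_on E x\<bar> \<partial>\<mu>) \<le> \<epsilon> * (\<integral>y. \<bar>uniform_on K y\<bar> \<partial>\<mu>)"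
  proof (rule convolution_diff_bound[OF aK(1) aE(1)])
    fix y assume "uniform_on K y \<noteq> 0"
    then have y: "y \<in> K" by (simp add: uniform_on_def split: split_indicator_asm)
    have mem: "- y + x \<in> E \<longleftrightarrow> x \<in> (\<lambda>x. y + x) ` E" for x
      by (force simp: image_iff add.assoc[symmetric])
    have "(\<lambda>x. \<bar>uniform_on E (- y + x) - 1 * uniform_on E x\<bar>) = (\<lambda>x. indicator (sym_diff ((\<lambda>x. y + x) ` E) E) x / measure \<mu> E)"
      using E(2) by (auto simp: uniform_on_def fun_eq_iff indicator_def mem)
    then have "(\<integral>x. \<bar>uniform_on E (- y + x) - 1 * uniform_on E x\<bar> \<partial>\<mu>) = measure \<mu> (sym_diff ((\<lambda>x. y + x) ` E) E) / measure \<mu> E"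
      by simp
    then show "(\<integral>x. \<bar>uniform_on E (- y + x) - 1 * uniform_on E x\<bar> \<partial>\<mu>) \<le> \<epsilon>" using inv[OF y] by simp
  qed (use \<epsilon> in simp)
  then show ?thesis using aK by (simp add: L1_norm_def)
qed

lemma convolution_diff_uniform_on:
  assumes K: "compact K" "0 < measure \<mu> K" and L: "compact L" "0 < measure \<mu> L"
    and E: "compact E" "0 < measure \<mu> E"
  shows "AE x in \<mu>. convolution \<mu> (\<lambda>x. (uniform_on K x - uniform_on L x) / 2) (uniform_on E) x
    = (convolution \<mu> (uniform_on K) (uniform_on E) x - convolution \<mu> (uniform_on L) (uniform_on E) x) / 2"
  using AE_integrable_convolution[OF uniform_on_props(1)[OF K] uniform_on_props(1)[OF E]]
    AE_integrable_convolution[OF uniform_on_props(1)[OF L] uniform_on_props(1)[OF E]]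
  by eventually_elim (simp add: convolution_def left_diff_distrib)

text \<open>Both convolutions are within \<epsilon> of \<open>uniform_on E\<close>, which cancels in
  their difference.\<close>

lemma convolution_diff_uniform_on_small:
  assumes K: "compact K" "0 < measure \<mu> K" and L: "compact L" "0 < measure \<mu> L"
    and E: "compact E" "0 < measure \<mu> E" and \<epsilon>: "0 < \<epsilon>"
    and inv: "\<And>y. y \<in> K \<union> L \<Longrightarrow> measure \<mu> (sym_diff ((\<lambda>x. y + x) ` E) E) / measure \<mu> E < \<epsilon>"
  shows "L1_norm \<mu> (convolution \<mu> (\<lambda>x. (uniform_on K x - uniform_on L x) / 2) (uniform_on E)) \<le> \<epsilon>"
proof -
  note i = uniform_on_props(1)[OF K] uniform_on_props(1)[OF L] uniform_on_props(1)[OF E]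
  note c = integrable_convolution[OF i(1,3)] integrable_convolution[OF i(2,3)]
  have "L1_norm \<mu> (convolution \<mu> (\<lambda>x. (uniform_on K x - uniform_on L x) / 2) (uniform_on E))
    \<le> 1/2 * (L1_norm \<mu> (\<lambda>x. convolution \<mu> (uniform_on K) (uniform_on E) x - uniform_on E x)
        + L1_norm \<mu> (\<lambda>x. convolution \<mu> (uniform_on L) (uniform_on E) x - uniform_on E x))"
  proof (rule L1_norm_le_add(1))
    show "convolution \<mu> (\<lambda>x. (uniform_on K x - uniform_on L x) / 2) (uniform_on E) \<in> borel_measurable \<mu>"
      using integrable_convolution[of "\<lambda>x. (uniform_on K x - uniform_on L x) / 2" "uniform_on E"] i by simp
    show "AE x in \<mu>. \<bar>convolution \<mu> (\<lambda>x. (uniform_on K x - uniform_on L x) / 2) (uniform_on E) x\<bar>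
      \<le> 1/2 * (\<bar>convolution \<mu> (uniform_on K) (uniform_on E) x - uniform_on E x\<bar> + \<bar>convolution \<mu> (uniform_on L) (uniform_on E) x - uniform_on E x\<bar>)"
      using convolution_diff_uniform_on[OF K L E] by eventually_elim auto
  qed (use i c in auto)
  moreover have "L1_norm \<mu> (\<lambda>x. convolution \<mu> (uniform_on K) (uniform_on E) x - uniform_on E x) \<le> \<epsilon>"
    using inv by (intro convolution_uniform_on_near K E \<epsilon>) auto
  moreover have "L1_norm \<mu> (\<lambda>x. convolution \<mu> (uniform_on L) (uniform_on E) x - uniform_on E x) \<le> \<epsilon>"
    using inv by (intro convolution_uniform_on_near L E \<epsilon>) auto
  ultimately show ?thesis by simp
qed

text \<open>The two convolutions are nonnegative and live on the disjoint sets K + E and L + E. The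
  absolute value of their difference is therefore their sum, and each has integral 1.\<close>

lemma convolution_diff_uniform_on_disjoint:
  assumes K: "compact K" "0 < measure \<mu> K" and L: "compact L" "0 < measure \<mu> L"
    and E: "compact E" "0 < measure \<mu> E"
    and disj: "\<And>k l e e'. k \<in> K \<Longrightarrow> l \<in> L \<Longrightarrow> e \<in> E \<Longrightarrow> e' \<in> E \<Longrightarrow> k + e \<noteq> l + e'"
  shows "L1_norm \<mu> (convolution \<mu> (\<lambda>x. (uniform_on K x - uniform_on L x) / 2) (uniform_on E)) = 1"
proof -
  note i = uniform_on_props(1)[OF K] uniform_on_props(1)[OF L] uniform_on_props(1)[OF E]
  note c = integrable_convolution[OF i(1,3)] integrable_convolution[OF i(2,3)]
  have nonneg: "0 \<le> convolution \<mu> (uniform_on A) (uniform_on E) x" if "compact A" "0 < measure \<mu> A" for A x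
    unfolding convolution_def using uniform_on_props(3)[OF that] uniform_on_props(3)[OF E] by (intro integral_nonneg_AE) auto
  have supp: "\<exists>y\<in>A. - y + x \<in> E" if "convolution \<mu> (uniform_on A) (uniform_on E) x \<noteq> 0" for A x
  proof (rule ccontr)
    assume "\<not> ?thesis"
    then have "(\<lambda>y. uniform_on A y * uniform_on E (- y + x)) = (\<lambda>_. 0)"
      by (auto simp: fun_eq_iff uniform_on_def split: split_indicator)
    then show False using that by (simp add: convolution_def)
  qed
  have zero: "convolution \<mu> (uniform_on K) (uniform_on E) x = 0 \<or> convolution \<mu> (uniform_on L) (uniform_on E) x = 0" for x
  proof (rule ccontr)
    assume "\<not> ?thesis"
    then obtain k l where "k \<in> K" "- k + x \<in> E" "l \<in> L" "- l + x \<in> E" using supp by meson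
    \<comment> \<open>Here \<open>x\<close> equals both k + (- k + x) and l + (- l + x).\<close>
    from disj[OF this(1,3,2,4)] show False by (simp add: add.assoc[symmetric])
  qed
  have "L1_norm \<mu> (convolution \<mu> (\<lambda>x. (uniform_on K x - uniform_on L x) / 2) (uniform_on E))
    = (\<integral>x. (convolution \<mu> (uniform_on K) (uniform_on E) x + convolution \<mu> (uniform_on L) (uniform_on E) x) / 2 \<partial>\<mu>)"
    unfolding L1_norm_def
  proof (rule integral_cong_AE)
    show "(\<lambda>x. \<bar>convolution \<mu> (\<lambda>x. (uniform_on K x - uniform_on L x) / 2) (uniform_on E) x\<bar>) \<in> borel_measurable \<mu>"
      using integrable_convolution[of "\<lambda>x. (uniform_on K x - uniform_on L x) / 2" "uniform_on E"] i by simp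
    show "AE x in \<mu>. \<bar>convolution \<mu> (\<lambda>x. (uniform_on K x - uniform_on L x) / 2) (uniform_on E) x\<bar>
      = (convolution \<mu> (uniform_on K) (uniform_on E) x + convolution \<mu> (uniform_on L) (uniform_on E) x) / 2"
      using convolution_diff_uniform_on[OF K L E]
    proof eventually_elim
      case (elim x)
      show ?case unfolding elim using zero[of x] nonneg[OF K, of x] nonneg[OF L, of x] by auto
    qed
  qed (use c in simp)
  also have "\<dots> = 1"
    using c integral_convolution[OF i(1,3)] integral_convolution[OF i(2,3)]
      uniform_on_props(2)[OF K] uniform_on_props(2)[OF L] uniform_on_props(2)[OF E] by simp
  finally show ?thesis .
qed

text \<open>Variable 0 holds \<open>g\<close> and variable 1 holds \<open>f\<close>, so the order of
  the arguments of \<open>ConvS\<close> yields f * g. Replacing the chosen representatives by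
  \<open>f\<close> and \<open>g\<close> leaves the convolution unchanged at every point.\<close>

lemma form_val_norm_conv:
  assumes f: "integrable \<mu> f" and g: "integrable \<mu> g"
  shows "form_val (L1_conv \<mu>) (Pred NormS [Fn ConvS [Var 1, Var 0]]) (\<lambda>i. ([L1_class \<mu> g] @ [L1_class \<mu> f]) ! i)
    = L1_norm \<mu> (convolution \<mu> f g)"
proof -
  note rf = rep_L1_class[OF f] and rg = rep_L1_class[OF g]
  have "convolution \<mu> (rep (L1_class \<mu> f)) (rep (L1_class \<mu> g)) = convolution \<mu> f g"
    using f g rf rg by (intro convolution_cong_AE(2) borel_measurable_integrable_haar)
  then show ?thesis
    using L1_norm_rep[OF integrable_convolution[OF f g]] by (simp add: L1_conv_def L1_fint_def)
qed

section \<open>Choice of the compact sets and the translations\<close>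

lemma exists_compact_pos:
  obtains K where "compact K" "0 < measure \<mu> K"
proof -
  have "emeasure \<mu> UNIV \<noteq> 0" by (rule haar_rules[THEN conjunct1])
  then have "0 < (SUP K\<in>{K. compact K \<and> K \<subseteq> UNIV}. emeasure \<mu> K)"
    using inner_regular_open[OF open_UNIV] by (simp add: zero_less_iff_neq_zero)
  then obtain K where K: "compact K" "0 < emeasure \<mu> K" by (auto simp: less_SUP_iff)
  then have "0 < measure \<mu> K" using finite_on_compact[OF K(1)] by (simp add: measure_def enn2real_positive_iff)
  then show thesis using K that by blast
qed

text \<open>
  Dependent choice of quadruples \<open>(P, Q, a, E)\<close>: \<open>P\<close> accumulates the translates of \<open>K\<close> under which
  later sets \<open>E\<close> must be almost invariant, and \<open>Q\<close> the points that later translations \<open>a\<close> must avoid.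
\<close>

lemma folner_escape_sequence:
  assumes nc: "\<not> compact (UNIV :: 'g set)" and am: "amenable \<mu>" and K: "compact (K :: 'g set)"
  obtains a :: "nat \<Rightarrow> 'g" and E :: "nat \<Rightarrow> 'g set" where
    "\<forall>n. compact (E n) \<and> 0 < measure \<mu> (E n)"
    "\<forall>m n. m \<le> n \<longrightarrow> (\<forall>y\<in>K \<union> (\<lambda>x. a m + x) ` K.
       measure \<mu> (sym_diff ((\<lambda>x. y + x) ` E n) (E n)) / measure \<mu> (E n) < 1 / Suc n)"
    "\<forall>m n. n < m \<longrightarrow> (\<forall>k\<in>K. \<forall>k'\<in>K. \<forall>e\<in>E n. \<forall>e'\<in>E n. k + e \<noteq> a m + k' + e')"
proof -
  \<comment> \<open>These are exactly the \<open>a\<close> for which a + (K + E) meets K +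
    E.\<close>
  define bad where "bad E = (\<lambda>(u, v). u - v) ` ((\<lambda>(k, e). k + e) ` (K \<times> E) \<times> (\<lambda>(k, e). k + e) ` (K \<times> E))" for E
  have bad: "compact (bad E)" if "compact E" for E
    unfolding bad_def by (intro compact_sumset K that)
  define fol where "fol n P E \<longleftrightarrow> compact E \<and> 0 < measure \<mu> E \<and>
    (\<forall>y\<in>P. measure \<mu> (sym_diff ((\<lambda>x. y + x) ` E) E) / measure \<mu> E < 1 / Suc n)" for n :: nat and P E
  have ex: "\<exists>E. fol n P E" if P: "compact P" for n P
  proof -
    have "0 < 1 / real (Suc n)" by simp
    with am P obtain E where E: "compact E" "0 < emeasure \<mu> E" "emeasure \<mu> E < \<infinity>"
      "\<forall>a\<in>P. measure \<mu> (sym_diff ((\<lambda>x. a + x) ` E) E) / measure \<mu> E < 1 / Suc n"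
      unfolding amenable_def by blast
    then show ?thesis unfolding fol_def
      by (intro exI[of _ E]) (simp add: measure_def enn2real_positive_iff)
  qed
  have tr: "compact ((\<lambda>x. a + x) ` K)" for a
    by (rule compact_continuous_image[OF _ K]) (intro continuous_intros)
  \<comment> \<open>Compactness of \<open>P\<close> allows the next Folner set to be chosen, and
    compactness of \<open>Q\<close> the next translation.\<close>
  define ok where "ok n st \<longleftrightarrow> (case st of (P, Q, a, E) \<Rightarrow> compact P \<and> compact Q \<and> fol n P E \<and>
      K \<subseteq> P \<and> (\<lambda>x. a + x) ` K \<subseteq> P \<and> bad E \<subseteq> Q)"
    for n and st :: "'g set \<times> 'g set \<times> 'g \<times> 'g set"
  define step where "step st st' \<longleftrightarrow> (case st of (P, Q, a, E) \<Rightarrow> case st' of (P', Q', a', E') \<Rightarrow>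
      P \<subseteq> P' \<and> Q \<subseteq> Q' \<and> a' \<notin> Q)"
    for st st' :: "'g set \<times> 'g set \<times> 'g \<times> 'g set"
  have "\<exists>f. \<forall>n. ok n (f n) \<and> step (f n) (f (Suc n))"
  proof (rule dependent_nat_choice)
    obtain E where E: "fol 0 K E" using ex[OF K] by blast
    \<comment> \<open>The initial translation is 0, so \<open>K\<close> is its own
      translate.\<close>
    have "ok 0 (K, bad E, 0, E)" using E K bad by (auto simp: ok_def fol_def)
    then show "\<exists>st. ok 0 st" by blast
  next
    fix st :: "'g set \<times> 'g set \<times> 'g \<times> 'g set" and n
    assume ok: "ok n st"
    obtain P Q a E where st: "st = (P, Q, a, E)" by (cases st)
    have PQ: "compact P" "compact Q" "K \<subseteq> P" using ok by (auto simp: ok_def st)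
    \<comment> \<open>A compact \<open>Q\<close> cannot be all of the non-compact group.\<close>
    obtain a' where a': "a' \<notin> Q" using nc PQ(2) by (metis UNIV_eq_I)
    have P': "compact (P \<union> (\<lambda>x. a' + x) ` K)" using PQ tr by (simp add: compact_Un)
    obtain E' where E': "fol (Suc n) (P \<union> (\<lambda>x. a' + x) ` K) E'" using ex[OF P'] by blast
    have "ok (Suc n) (P \<union> (\<lambda>x. a' + x) ` K, Q \<union> bad E', a', E')"
      using P' PQ E' bad by (auto simp: ok_def fol_def compact_Un)
    moreover have "step st (P \<union> (\<lambda>x. a' + x) ` K, Q \<union> bad E', a', E')"
      using a' by (simp add: step_def st)
    ultimately show "\<exists>st'. ok (Suc n) st' \<and> step st st'" by blast
  qed
  then obtain f where f: "\<And>n. ok n (f n)" "\<And>n. step (f n) (f (Suc n))" by blast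
  define P where "P n = fst (f n)" for n
  define Q where "Q n = fst (snd (f n))" for n
  define a where "a n = fst (snd (snd (f n)))" for n
  define E where "E n = snd (snd (snd (f n)))" for n
  have o: "fol n (P n) (E n)" "K \<subseteq> P n" "(\<lambda>x. a n + x) ` K \<subseteq> P n" "bad (E n) \<subseteq> Q n" for n
    using f(1)[of n] by (auto simp: ok_def P_def Q_def a_def E_def split: prod.splits)
  have s: "P n \<subseteq> P (Suc n)" "Q n \<subseteq> Q (Suc n)" "a (Suc n) \<notin> Q n" for n
    using f(2)[of n] by (auto simp: step_def P_def Q_def a_def E_def split: prod.splits)
  have Pm: "P m \<subseteq> P n" and Qm: "Q m \<subseteq> Q n" if "m \<le> n" for m n
    using lift_Suc_mono_le[of P m n] lift_Suc_mono_le[of Q m n] s that by auto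
  show thesis
  proof (rule that[of E a])
    show "\<forall>n. compact (E n) \<and> 0 < measure \<mu> (E n)" using o(1) by (auto simp: fol_def)
    show "\<forall>m n. m \<le> n \<longrightarrow> (\<forall>y\<in>K \<union> (\<lambda>x. a m + x) ` K.
       measure \<mu> (sym_diff ((\<lambda>x. y + x) ` E n) (E n)) / measure \<mu> (E n) < 1 / Suc n)"
    proof (intro allI impI ballI)
      fix m n y assume "m \<le> n" "y \<in> K \<union> (\<lambda>x. a m + x) ` K"
      then have "y \<in> P n" using o(2,3)[of m] Pm[of m n] by blast
      then show "measure \<mu> (sym_diff ((\<lambda>x. y + x) ` E n) (E n)) / measure \<mu> (E n) < 1 / Suc n"
        using o(1)[of n] unfolding fol_def by blast
    qed
    show "\<forall>m n. n < m \<longrightarrow> (\<forall>k\<in>K. \<forall>k'\<in>K. \<forall>e\<in>E n. \<forall>e'\<in>E n. k + e \<noteq> a m + k' + e')"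
    proof (intro allI impI ballI notI)
      fix m n k k' e e'
      assume nm: "n < m" and mem: "k \<in> K" "k' \<in> K" "e \<in> E n" "e' \<in> E n" and eq: "k + e = a m + k' + e'"
      have "a m = (k + e) - (k' + e')" using eq by (simp add: add.assoc)
      then have "a m \<in> bad (E n)" unfolding bad_def using mem
        by (intro image_eqI[of _ _ "(k + e, k' + e')"]) auto
      \<comment> \<open>The point \<open>a m\<close> avoids \<open>Q (m - 1)\<close>, which contains
        \<open>Q n\<close> and hence \<open>bad (E n)\<close>.\<close>
      moreover have "m = Suc (m - 1)" "n \<le> m - 1" using nm by auto
      ultimately show False using o(4)[of n] Qm[of n "m - 1"] s(3)[of "m - 1"] by auto
    qed
  qed
qed

end

theorem proposition4p23:
  fixes \<mu> :: "'g::{topological_group_add, t2_space} measure"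
  assumes "locally_compact_space (euclidean :: 'g topology)"
    and "\<not> compact (UNIV :: 'g set)"
    and "left_haar_measure \<mu>"
    and "amenable \<mu>"
  shows "unstable TYPE(('g \<Rightarrow> real) set) L_cnv (Th L_cnv (L1_conv \<mu>))"
proof -
  interpret haar \<mu> using assms by unfold_locales
  obtain K where K: "compact K" "0 < measure \<mu> K" by (rule exists_compact_pos)
  obtain a E where E': "\<forall>n. compact (E n) \<and> 0 < measure \<mu> (E n)"
    and inv: "\<forall>m n. m \<le> n \<longrightarrow> (\<forall>y\<in>K \<union> (\<lambda>x. a m + x) ` K.
       measure \<mu> (sym_diff ((\<lambda>x. y + x) ` E n) (E n)) / measure \<mu> (E n) < 1 / Suc n)"
    and disj: "\<forall>m n. n < m \<longrightarrow> (\<forall>k\<in>K. \<forall>k'\<in>K. \<forall>e\<in>E n. \<forall>e'\<in>E n. k + e \<noteq> a m + k' + e')"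
    using folner_escape_sequence[OF assms(2,4) K(1)] .
  have E: "compact (E n)" "0 < measure \<mu> (E n)" for n using E' by auto
  define L where "L m = (\<lambda>x. a m + x) ` K" for m
  have L: "compact (L m)" "0 < measure \<mu> (L m)" for m
  proof -
    show "compact (L m)" unfolding L_def
      by (rule compact_continuous_image[OF _ K(1)]) (intro continuous_intros)
    show "0 < measure \<mu> (L m)" using K emeasure_translate[OF borel_compact_group[OF K(1)]]
      by (simp add: L_def measure_def)
  qed
  define p where "p n = uniform_on (E n)" for n
  \<comment> \<open>The factor 1/2 keeps the difference of two functions of norm 1 in the unit
    ball.\<close>
  define q where "q m x = (uniform_on K x - uniform_on (L m) x) / 2" for m x
  note iK = uniform_on_props[OF K] and iL = uniform_on_props[OF L] and iE = uniform_on_props[OF E]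
  have p: "integrable \<mu> (p n)" "L1_norm \<mu> (p n) \<le> 1" for n
    using iE by (auto simp: p_def)
  have q: "integrable \<mu> (q m)" "L1_norm \<mu> (q m) \<le> 1" for m
  proof -
    show i: "integrable \<mu> (q m)" unfolding q_def using iK(1) iL(1) by simp
    have "L1_norm \<mu> (q m) \<le> 1/2 * (L1_norm \<mu> (uniform_on K) + L1_norm \<mu> (uniform_on (L m)))"
      using iK(1) iL(1) i by (intro L1_norm_le_add(1)) (auto simp: q_def)
    then show "L1_norm \<mu> (q m) \<le> 1" using iK(4) iL(4) by simp
  qed
  let ?\<phi> = "Pred NormS [Fn ConvS [Var 1, Var 0]]"
  define F where "F n m = form_val (L1_conv \<mu>) ?\<phi> (\<lambda>i. ([L1_class \<mu> (p n)] @ [L1_class \<mu> (q m)]) ! i)" for n m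
  have F: "F n m = L1_norm \<mu> (convolution \<mu> (q m) (p n))" for n m
    unfolding F_def by (rule form_val_norm_conv[OF q(1) p(1)])
  have F1: "F n m = 1" if "n < m" for n m
    unfolding F q_def p_def
    by (rule convolution_diff_uniform_on_disjoint[OF K L E]) (use disj that in \<open>auto simp: L_def\<close>)
  have F0: "F n m \<le> 1 / Suc n" if "m \<le> n" for n m
    unfolding F q_def p_def
    by (rule convolution_diff_uniform_on_small[OF K L E]) (use inv[rule_format, OF that] in \<open>auto simp: L_def\<close>)
  \<comment> \<open>For fixed \<open>n\<close> the values are 1 as soon as \<open>m\<close> exceeds
    \<open>n\<close>.\<close>
  have lim1: "iterated_limit F 1"
    unfolding iterated_limit_def
  proof (intro exI[of _ "\<lambda>_. 1"] conjI allI tendsto_const)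
    fix n
    have "\<forall>\<^sub>F m in sequentially. F n m = 1"
      by (rule eventually_sequentiallyI[of "Suc n"]) (simp add: F1)
    then show "(\<lambda>m. F n m) \<longlonglongrightarrow> 1" by (rule tendsto_eventually)
  qed
  \<comment> \<open>For fixed \<open>m\<close> the values are at most \<open>1 / Suc n\<close> from
    \<open>n = m\<close> on.\<close>
  have lim0: "iterated_limit (\<lambda>m n. F n m) 0"
    unfolding iterated_limit_def
  proof (intro exI[of _ "\<lambda>_. 0"] conjI allI tendsto_const)
    fix m
    show "(\<lambda>n. F n m) \<longlonglongrightarrow> 0"
    proof (rule tendsto_sandwich[OF _ _ tendsto_const LIMSEQ_divide_Suc])
      show "\<forall>\<^sub>F n in sequentially. 0 \<le> F n m" by (simp add: F)
      show "\<forall>\<^sub>F n in sequentially. F n m \<le> 1 / Suc n"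
        by (rule eventually_sequentiallyI[of m]) (rule F0)
    qed
  qed
  \<comment> \<open>The structure satisfies its own theory, so it serves as the model witnessing
    instability.\<close>
  have "models L_cnv (L1_conv \<mu>) (Th L_cnv (L1_conv \<mu>))"
    using metric_structure_L1_conv by (simp add: models_def Th_def)
  moreover have "wf_form L_cnv ?\<phi>" by (simp add: L_cnv_def)
  moreover have "fv_form ?\<phi> \<subseteq> {..<1 + 1}" by auto
  moreover have "[L1_class \<mu> (p n)] \<in> tuples (univ (L1_conv \<mu>)) 1" for n
    using L1_ballI[OF p] by (simp add: tuples_def L1_conv_def)
  moreover have "[L1_class \<mu> (q m)] \<in> tuples (univ (L1_conv \<mu>)) 1" for m
    using L1_ballI[OF q] by (simp add: tuples_def L1_conv_def)
  ultimately show ?thesis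
    unfolding unstable_def
    using lim1 lim0 unfolding F_def
    by (intro exI[of _ "L1_conv \<mu>"] exI[of _ ?\<phi>] exI[of _ 1] exI[of _ "\<lambda>n. [L1_class \<mu> (p n)]"]
        exI[of _ "\<lambda>m. [L1_class \<mu> (q m)]"] exI[of _ "1::real"] exI[of _ "0::real"] conjI allI) simp_all
qed

end
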